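(* Let $A$ be an expanding $d\times d$ integral matrix whose eigenvalue of least absolute value has absolute value $\lambda>1$, and let $1\le r\le\infty$. There is a constant $C>0$ depending only on $A$ and $r$ such that for every $f\in L^r(\mu)$ with $\int f\,d\mu=0$ and every $n\ge1$, $$\|\mathcal{L}^n f\|_r\le C\,\Omega_{f,r}(\lambda^{-n}).$$
   Context: $\mathbb{T}^d=\mathbb{R}^d/\mathbb{Z}^d$, $\mu$ is normalized Haar measure on $\mathbb{T}^d$, $\|\cdot\|_r$ is the $L^r(\mu)$ norm. An integral matrix $A$ is expanding if all its eigenvalues have absolute value $>1$. Let $q=|\det A|$ and let $D\subset\mathbb{Z}^d$ be a set containing exactly one representative of each coset of $\mathbb{Z}^d/A\mathbb{Z}^d$ (so $|D|=q$). The transfer operator is $\mathcal{L}f(x)=\frac1q\sum_{\gamma\in D} f(A^{-1}(x+\gamma))$ (a well-defined function on $\mathbb{T}^d$, independent of the choice of $D$). For $1\le r<\infty$, $\Omega_{f,r}(\delta)=\sup_{|v|\le\delta}\|f(\cdot+v)-f(\cdot)\|_r$ ($|v|$ Euclidean norm), and for $r=\infty$, $\Omega_{f,\infty}(\delta)=\Omega_f(\delta)=\sup_{|x-y|\le\delta}|f(x)-f(y)|$ (distance on the torus induced by the Euclidean norm). *)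

theory Defs
  imports "HOL-Analysis.Analysis" "HOL-Probability.Essential_Supremum"
begin

text \<open>Points of the torus are represented by points of R^d; functions on the torus
  are Z^d-periodic functions on R^d.\<close>

definition int_vec :: "real^'d \<Rightarrow> bool" where
  "int_vec k \<longleftrightarrow> (\<forall>i. k $ i \<in> \<int>)"

definition integral_matrix :: "real^'d^'d \<Rightarrow> bool" where
  "integral_matrix A \<longleftrightarrow> (\<forall>i j. A $ i $ j \<in> \<int>)"

definition cmat :: "real^'d^'d \<Rightarrow> complex^'d^'d" where
  "cmat A = (\<chi> i j. complex_of_real (A $ i $ j))"

definition eigenvalue :: "real^'d^'d \<Rightarrow> complex \<Rightarrow> bool" where
  "eigenvalue A z \<longleftrightarrow> det (cmat A - mat z) = 0"

definition expanding :: "real^'d^'d \<Rightarrow> bool" where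
  "expanding A \<longleftrightarrow> (\<forall>z. eigenvalue A z \<longrightarrow> cmod z > 1)"

definition periodic_fun :: "(real^'d \<Rightarrow> real) \<Rightarrow> bool" where
  "periodic_fun f \<longleftrightarrow> (\<forall>x k. int_vec k \<longrightarrow> f (x + k) = f x)"

text \<open>normalized Haar measure on the torus, via the unit cube as fundamental domain\<close>
definition torus_measure :: "(real^'d) measure" where
  "torus_measure = lebesgue_on (cbox 0 One)"

definition digit_set :: "real^'d^'d \<Rightarrow> (real^'d) set \<Rightarrow> bool" where
  "digit_set A D \<longleftrightarrow> (\<forall>g\<in>D. int_vec g) \<and>
     (\<forall>k. int_vec k \<longrightarrow> (\<exists>!g. g \<in> D \<and> (\<exists>m. int_vec m \<and> k - g = A *v m)))"

definition transfer :: "real^'d^'d \<Rightarrow> (real^'d) set \<Rightarrow> (real^'d \<Rightarrow> real) \<Rightarrow> (real^'d \<Rightarrow> real)" where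
  "transfer A D f = (\<lambda>x. (1 / \<bar>det A\<bar>) * (\<Sum>g\<in>D. f (matrix_inv A *v (x + g))))"

definition in_Lr :: "ereal \<Rightarrow> (real^'d \<Rightarrow> real) \<Rightarrow> bool" where
  "in_Lr r f \<longleftrightarrow> f \<in> borel_measurable torus_measure \<and>
     (if r = \<infinity> then esssup torus_measure (\<lambda>x. ereal \<bar>f x\<bar>) < \<infinity>
      else integrable torus_measure (\<lambda>x. \<bar>f x\<bar> powr real_of_ereal r))"

definition Lr_norm :: "ereal \<Rightarrow> (real^'d \<Rightarrow> real) \<Rightarrow> real" where
  "Lr_norm r f = (if r = \<infinity> then real_of_ereal (esssup torus_measure (\<lambda>x. ereal \<bar>f x\<bar>))
     else (integral\<^sup>L torus_measure (\<lambda>x. \<bar>f x\<bar> powr real_of_ereal r)) powr (1 / real_of_ereal r))"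

definition torus_dist :: "real^'d \<Rightarrow> real^'d \<Rightarrow> real" where
  "torus_dist x y = Inf {norm (x - y - k) | k. int_vec k}"

definition modulus :: "ereal \<Rightarrow> (real^'d \<Rightarrow> real) \<Rightarrow> real \<Rightarrow> ereal" where
  "modulus r f \<delta> = (if r = \<infinity>
     then (SUP (x, y) \<in> {(x, y). torus_dist x y \<le> \<delta>}. ereal \<bar>f x - f y\<bar>)
     else (SUP v \<in> {v. norm v \<le> \<delta>}. ereal (Lr_norm r (\<lambda>x. f (x + v) - f x))))"

end

theory Submission
  imports Defs
    "HOL-Computational_Algebra.Fundamental_Theorem_Algebra"
    "HOL-Computational_Algebra.Polynomial_Factorial"
    "HOL-Computational_Algebra.Field_as_Ring"
    "HOL-Probability.Probability_Measure"
begin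

text \<open>Averaging over digits, \<open>(\<L>\<^sup>nf)(x) - (\<L>\<^sup>nf)(x + t)\<close> is \<open>\<L>\<^sup>n\<close> of the difference of \<open>f\<close> and its
  translate by \<open>w\<close>, where \<open>w\<close> is any representative of \<open>A\<^sup>-\<^sup>nt\<close> modulo the lattice \<open>A\<^sup>-\<^sup>n\<int>\<^sup>d\<close>. As
  \<open>\<L>\<^sup>nf\<close> has mean zero, it is the average over \<open>t\<close> of these differences, and since \<open>\<L>\<^sup>n\<close> is a contraction
  of \<open>L\<^sup>r\<close>, its norm is at most \<open>\<Omega>\<close> at the covering radius of the lattice. If \<open>A\<close> is not
  diagonalizable, the operator norm of \<open>A\<^sup>-\<^sup>n\<close> need not be \<open>O(\<lambda>\<^sup>-\<^sup>n)\<close>, but the covering radius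
  still is, because \<open>A\<close> has a rational filtration with semisimple quotients.\<close>

section \<open>Polynomials in a matrix\<close>

text \<open>Lattice points can be subtracted along the ranges of Q^j only if Q itself maps integral
  vectors to integral vectors. The squarefree part of the characteristic polynomial must therefore
  be rational, although its roots are only algebraic. The covering radius is bounded by C
  \<lambda>^-n with a C that may exceed 1, whereas the modulus is taken at \<lambda>^-n. A
  translation is therefore cut into N \<ge> C equal steps, at the cost of a factor N; this N is the
  final constant, the same for every r. A function in L^r is only Lebesgue measurable on the closed
  cube, while Tonelli and compositions with affine maps are carried out for Borel functions. It is
  replaced by a periodic Borel function that equals it almost everywhere. For r = \<infinity> the
  modulus is a supremum over all points, so there the replacement is confined to integrals.\<close>

definition poly_act :: "complex^'d^'d \<Rightarrow> complex poly \<Rightarrow> complex^'d \<Rightarrow> complex^'d" where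
  "poly_act M p v = fold_coeffs (\<lambda>a w. a *s v + M *v w) p 0"

lemma poly_act_0 [simp]: "poly_act M 0 v = 0"
  by (simp add: poly_act_def)

lemma poly_act_pCons [simp]: "poly_act M (pCons a p) v = a *s v + M *v poly_act M p v"
  by (cases "p = 0 \<and> a = 0") (auto simp: poly_act_def)

lemma poly_act_1 [simp]: "poly_act M 1 v = v"
  by (simp add: one_pCons)

lemma poly_act_add: "poly_act M (p + q) v = poly_act M p v + poly_act M q v"
  by (induction p q rule: poly_induct2)
     (simp_all add: vec.scale_left_distrib matrix_vector_right_distrib algebra_simps)

lemma poly_act_smult: "poly_act M (smult c p) v = c *s poly_act M p v"
  by (induction p) (simp_all add: vec.scale_right_distrib vec.scale)

lemma poly_act_diff: "poly_act M (p - q) v = poly_act M p v - poly_act M q v"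
proof -
  have "poly_act M (p - q) v = poly_act M (p + smult (-1) q) v" by simp
  also have "\<dots> = poly_act M p v - poly_act M q v"
    unfolding poly_act_add poly_act_smult by (simp add: vec_eq_iff)
  finally show ?thesis .
qed

lemma poly_act_mult: "poly_act M (p * q) v = poly_act M p (poly_act M q v)"
  by (induction p) (simp_all add: poly_act_add poly_act_smult)

lemma poly_act_commute: "poly_act M p (poly_act M q v) = poly_act M q (poly_act M p v)"
  by (metis poly_act_mult mult.commute)

lemma poly_act_vec_add: "poly_act M p (v + w) = poly_act M p v + poly_act M p w"
  by (induction p) (simp_all add: vec.scale_right_distrib matrix_vector_right_distrib algebra_simps)

lemma poly_act_vec_scale: "poly_act M p (c *s v) = c *s poly_act M p v"
  by (induction p) (simp_all add: vec.scale_right_distrib vec.scale mult.commute)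

lemma poly_act_vec_diff: "poly_act M p (v - w) = poly_act M p v - poly_act M p w"
proof -
  have "v - w = v + (-1) *s w" by (simp add: vec_eq_iff)
  then have "poly_act M p (v - w) = poly_act M p v + (-1) *s poly_act M p w"
    by (simp only: poly_act_vec_add poly_act_vec_scale)
  then show ?thesis by (simp add: vec_eq_iff)
qed

lemma poly_act_vec_0 [simp]: "poly_act M p 0 = 0"
  using poly_act_vec_scale[of M p 0 0] by simp

lemma poly_act_sum: "poly_act M (\<Sum>i\<in>I. p i) v = (\<Sum>i\<in>I. poly_act M (p i) v)"
  by (induction I rule: infinite_finite_induct) (simp_all add: poly_act_add)

lemma poly_act_vec_sum: "poly_act M p (\<Sum>i\<in>I. v i) = (\<Sum>i\<in>I. poly_act M p (v i))"
  by (induction I rule: infinite_finite_induct) (simp_all add: poly_act_vec_add)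

lemma poly_act_monom: "poly_act M (monom c n) v = c *s (((*v) M) ^^ n) v"
  by (induction n) (simp_all add: monom_0 monom_Suc vec.scale)

lemma poly_act_X_power: "poly_act M ([:0, 1:] ^ n) v = (((*v) M) ^^ n) v"
  by (induction n) (simp_all add: poly_act_mult del: mult_pCons_left)

lemma poly_act_bounded: "\<exists>K\<ge>0. \<forall>v. norm (poly_act M p v) \<le> K * norm v"
proof -
  have "linear (poly_act M p)"
  proof (rule linearI)
    have "r *\<^sub>R w = complex_of_real r *s w" for r and w :: "complex^'a"
      unfolding vec_eq_iff vector_scaleR_component vector_smult_component
      by (simp add: scaleR_conv_of_real)
    then show "poly_act M p (r *\<^sub>R v) = r *\<^sub>R poly_act M p v" for r v
      by (simp only: poly_act_vec_scale)
  qed (rule poly_act_vec_add)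
  then have "bounded_linear (poly_act M p)"
    by (simp add: linear_conv_bounded_linear)
  then show ?thesis
    using bounded_linear.nonneg_bounded[of "poly_act M p"] by (auto simp: mult.commute)
qed

lemma mat_vector_mult: "mat z *v x = z *s x" for x :: "'a::comm_semiring_1^'d"
  by (simp add: vec_eq_iff matrix_vector_mult_def mat_def if_distribR if_distrib cong: if_cong)

text \<open>In dimension d the d + 1 vectors v, M v, ..., M^d v are dependent, which yields a
  polynomial killing v. The product of these polynomials over the standard basis kills every vector,
  since polynomials in M commute.\<close>

lemma ex_annihilating_poly: "\<exists>p\<noteq>0. \<forall>v. poly_act M p v = 0"
proof -
  have one: "\<exists>p\<noteq>0. poly_act M p v = 0" for v
  proof (cases "inj_on (\<lambda>i. (((*v) M) ^^ i) v) {..CARD('a)}")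
    \<comment> \<open>Dependence is a property of sets, so a repetition among the iterates is
      treated apart: it gives the annihilator X^i - X^j directly.\<close>
    case False
    then obtain i j where ij: "i \<noteq> j" "(((*v) M) ^^ i) v = (((*v) M) ^^ j) v"
      by (auto simp: inj_on_def)
    have "coeff (monom 1 i - monom 1 j :: complex poly) i \<noteq> 0"
      using ij by simp
    then have "(monom 1 i - monom 1 j :: complex poly) \<noteq> 0"
      by (metis coeff_0)
    moreover have "poly_act M (monom 1 i - monom 1 j) v = 0"
      using ij by (simp add: poly_act_diff poly_act_monom)
    ultimately show ?thesis by blast
  next
    case inj: True
    let ?B = "(\<lambda>i. (((*v) M) ^^ i) v) ` {..CARD('a)}"
    have "vec.dim ?B \<le> CARD('a)"
      using vec.dim_subset[of ?B UNIV] unfolding vec_dim_card by simp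
    then have "vec.dependent ?B"
      by (intro vec.dependent_biggerset_general) (simp add: card_image inj)
    then obtain u w where u: "(\<Sum>w\<in>?B. u w *s w) = 0" "w \<in> ?B" "u w \<noteq> 0"
      by (auto simp: vec.dependent_finite)
    define p where "p = (\<Sum>i\<le>CARD('a). monom (u ((((*v) M) ^^ i) v)) i)"
    obtain i where i: "i \<le> CARD('a)" "u ((((*v) M) ^^ i) v) \<noteq> 0"
      using u by auto
    have "coeff p i = u ((((*v) M) ^^ i) v)"
      using i by (simp add: p_def coeff_sum)
    then have "p \<noteq> 0" using i by (metis coeff_0)
    moreover have "poly_act M p v = 0"
      using u(1) by (simp add: p_def poly_act_sum poly_act_monom sum.reindex[OF inj])
    ultimately show ?thesis by blast
  qed
  then obtain p where p: "\<And>v. p v \<noteq> 0" "\<And>v. poly_act M (p v) v = 0"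
    by metis
  define P where "P = (\<Prod>i\<in>UNIV. p (axis i 1))"
  have axis: "poly_act M P (axis i 1) = 0" for i
  proof -
    have "P = (\<Prod>j\<in>UNIV - {i}. p (axis j 1)) * p (axis i 1)"
      unfolding P_def by (subst prod.remove[of _ i]) (auto simp: mult.commute)
    then show ?thesis by (simp add: poly_act_mult p)
  qed
  have "poly_act M P v = 0" for v
  proof -
    have "v = (\<Sum>i\<in>UNIV. v $ i *s axis i 1)"
      by (simp add: basis_expansion)
    then have "poly_act M P v = (\<Sum>i\<in>UNIV. v $ i *s poly_act M P (axis i 1))"
      by (metis (no_types, lifting) poly_act_vec_scale poly_act_vec_sum sum.cong)
    then show ?thesis by (simp add: axis)
  qed
  moreover have "P \<noteq> 0" by (simp add: P_def p)
  ultimately show ?thesis by blast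
qed

text \<open>Take an annihilator of least degree: at a root z with M - z invertible, the factor X - z
  could be cancelled, contradicting minimality.\<close>

lemma ex_annihilating_poly_roots:
  "\<exists>p\<noteq>0. (\<forall>v. poly_act M p v = 0) \<and> (\<forall>z. poly p z = 0 \<longrightarrow> det (M - mat z) = 0)"
proof -
  define Q where "Q p \<longleftrightarrow> p \<noteq> 0 \<and> (\<forall>v. poly_act M p v = 0)" for p
  obtain p where p: "Q p" and min: "\<And>q. Q q \<Longrightarrow> degree p \<le> degree q"
    using ex_annihilating_poly[of M] ex_has_least_nat[of Q _ degree] unfolding Q_def by metis
  have "det (M - mat z) = 0" if z: "poly p z = 0" for z
  proof (rule ccontr)
    assume nz: "det (M - mat z) \<noteq> 0"
    obtain q where q: "p = [:-z, 1:] * q"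
      using z by (auto simp: poly_eq_0_iff_dvd)
    have "q \<noteq> 0" using p q by (auto simp: Q_def)
    have "poly_act M q v = 0" for v
    proof -
      have "(M - mat z) *v poly_act M q v = poly_act M ([:-z, 1:] * q) v"
        unfolding poly_act_mult
        by (simp add: matrix_vector_mult_diff_rdistrib mat_vector_mult vec_eq_iff)
      also have "\<dots> = 0" using p q by (simp add: Q_def)
      finally show ?thesis
        using nz by (metis invertible_det_nz inj_matrix_vector_mult injD matrix_vector_mult_0_right)
    qed
    then have "degree p \<le> degree q" using \<open>q \<noteq> 0\<close> by (intro min) (simp add: Q_def)
    moreover have "degree p = Suc (degree q)"
      unfolding q using \<open>q \<noteq> 0\<close> by (subst degree_mult_eq) auto
    ultimately show False by simp
  qed
  then show ?thesis using p by (auto simp: Q_def)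
qed

text \<open>The determinant of A - X is formed over \<int>[X]. The Leibniz formula uses only sums
  and products, so evaluation at a complex z passes through it to the entries.\<close>

lemma ex_int_charpoly:
  assumes "integral_matrix A"
  shows "\<exists>P::int poly. \<forall>z. poly (map_poly of_int P) z = det (cmat A - mat z)"
proof -
  define a where "a i j = \<lfloor>A $ i $ j\<rfloor>" for i j
  have a: "A $ i $ j = of_int (a i j)" for i j
    using assms by (auto simp: integral_matrix_def a_def elim!: Ints_cases)
  define X :: "int poly^'a^'a" where "X = (\<chi> i j. if i = j then [:a i j, -1:] else [:a i j:])"
  have hom_add: "poly (map_poly of_int (p + q)) z = poly (map_poly of_int p) z + poly (map_poly of_int q) z"
    for p q and z :: complex
    by (induction p q rule: poly_induct2) (simp_all add: map_poly_pCons algebra_simps)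
  have hom_smult: "poly (map_poly of_int (smult c q)) z = of_int c * poly (map_poly of_int q) z" for c q and z :: complex
    by (induction q) (simp_all add: map_poly_pCons algebra_simps)
  have hom_mult: "poly (map_poly of_int (p * q)) z = poly (map_poly of_int p) z * poly (map_poly of_int q) z"
    for p q and z :: complex
    by (induction p) (simp_all add: map_poly_pCons hom_add hom_smult algebra_simps)
  have hom_sum: "poly (map_poly of_int (\<Sum>i\<in>I. f i)) z = (\<Sum>i\<in>I. poly (map_poly of_int (f i)) z)"
    for f :: "_ \<Rightarrow> int poly" and I and z :: complex
    by (induction I rule: infinite_finite_induct) (simp_all add: hom_add)
  have hom_prod: "poly (map_poly of_int (\<Prod>i\<in>I. f i)) z = (\<Prod>i\<in>I. poly (map_poly of_int (f i)) z)"
    for f :: "_ \<Rightarrow> int poly" and I and z :: complex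
    by (induction I rule: infinite_finite_induct) (simp_all add: hom_mult)
  have "poly (map_poly of_int (det X)) z = det (cmat A - mat z)" for z
    unfolding det_def hom_sum hom_mult hom_prod
    by (intro sum.cong refl arg_cong2[where f = "(*)"] prod.cong)
       (auto simp: X_def cmat_def mat_def a map_poly_pCons of_int_poly)
  then show ?thesis by blast
qed

section \<open>Rationality of the squarefree part of an integer polynomial\<close>

lemma map_poly_of_rat_add: "map_poly of_rat (p + q) = (map_poly of_rat p + map_poly of_rat q :: 'a::field_char_0 poly)"
  by (intro poly_eqI) (simp add: coeff_map_poly of_rat_add)

lemma map_poly_of_rat_mult: "map_poly of_rat (p * q) = (map_poly of_rat p * map_poly of_rat q :: 'a::field_char_0 poly)"
  by (induction p) (simp_all add: map_poly_pCons map_poly_smult map_poly_of_rat_add of_rat_mult)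

lemma map_poly_of_rat_pderiv: "map_poly of_rat (pderiv p) = (pderiv (map_poly of_rat p) :: 'a::field_char_0 poly)"
  by (intro poly_eqI) (simp add: coeff_map_poly coeff_pderiv of_rat_mult of_rat_add)

lemma ex_int_multiple_rat_poly: "\<exists>c q. c \<noteq> 0 \<and> map_poly of_int q = smult (of_int c) (p :: rat poly)"
proof (induction p)
  case 0
  show ?case by (intro exI[of _ 1] exI[of _ 0]) simp
next
  case (pCons a p)
  then obtain c q where c: "c \<noteq> 0" "map_poly of_int q = smult (of_int c) p" by blast
  obtain n d where a: "a = of_int n / of_int d" "d \<noteq> 0"
    by (cases a) (auto simp: Fract_of_int_quotient)
  have "map_poly of_int (pCons (c * n) (smult d q)) = smult (of_int (d * c)) (pCons a p)"
    using a c by (simp add: map_poly_pCons map_poly_smult)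
  then show ?case using c a by (metis mult_eq_0_iff)
qed

text \<open>The product of the distinct linear factors is the monic form of p / gcd(p, p'), and this
  gcd can be computed over \<rat>. The factor \<open>c\<close> clears denominators.\<close>

lemma ex_int_squarefree_part:
  fixes P :: "int poly"
  assumes "degree P > 0"
  shows "\<exists>c q. c \<noteq> 0 \<and> map_poly of_int q =
    smult (of_int c) (\<Prod>z | poly (map_poly of_int P) z = 0. [:-z, 1 :: complex:])"
proof -
  define p :: "rat poly" where "p = map_poly of_int P"
  have pC: "map_poly of_rat p = (map_poly of_int P :: complex poly)"
    by (simp add: p_def map_poly_map_poly o_def)
  have "degree p > 0" using assms by (simp add: p_def degree_map_poly)
  then have dp: "pderiv p \<noteq> 0" by (simp add: pderiv_eq_0_iff)
  define d where "d = gcd p (pderiv p)"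
  obtain q where q: "p = q * d" by (metis d_def gcd_dvd1 dvdE mult.commute)
  obtain e where e: "pderiv p = e * d" by (metis d_def gcd_dvd2 dvdE mult.commute)
  \<comment> \<open>The Bezout identity over \<rat> survives the embedding into \<complex>, so
    \<open>d\<close> is still a gcd of p and p' there.\<close>
  obtain r s where rs: "d = r * p + s * pderiv p"
    unfolding d_def by (metis bezout_coefficients_fst_snd)
  let ?m = "map_poly of_rat :: rat poly \<Rightarrow> complex poly"
  have "rsquarefree (?m q) \<and> (\<forall>a. poly (?m q) a = 0 \<longleftrightarrow> poly (?m p) a = 0)"
  proof (rule poly_squarefree_decomp)
    show "pderiv (?m p) \<noteq> 0"
      using dp by (simp add: map_poly_eq_0_iff flip: map_poly_of_rat_pderiv)
    show "?m p = ?m q * ?m d" by (subst q) (rule map_poly_of_rat_mult)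
    show "pderiv (?m p) = ?m e * ?m d"
      by (subst map_poly_of_rat_pderiv[symmetric]) (simp add: e map_poly_of_rat_mult)
    show "?m d = ?m r * ?m p + ?m s * pderiv (?m p)"
      by (subst rs) (simp add: map_poly_of_rat_mult map_poly_of_rat_add map_poly_of_rat_pderiv)
  qed
  then have sq: "rsquarefree (?m q)"
    and roots: "poly (?m q) a = 0 \<longleftrightarrow> poly (map_poly of_int P) a = 0" for a
    by (auto simp: pC)
  define R where "R = (\<Prod>z | poly (map_poly of_int P) z = 0. [:-z, 1 :: complex:])"
  have dec: "smult (lead_coeff (?m q)) R = ?m q"
    using complex_poly_decompose_rsquarefree[OF sq] by (simp add: roots R_def)
  have "q \<noteq> 0" using dp q by auto
  define q1 where "q1 = smult (inverse (lead_coeff q)) q"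
  have q1: "?m q1 = R"
  proof -
    have "?m q1 = smult (inverse (of_rat (lead_coeff q))) (?m q)"
      unfolding q1_def by (simp add: map_poly_smult of_rat_inverse of_rat_mult)
    also have "of_rat (lead_coeff q) = lead_coeff (?m q)"
      using \<open>q \<noteq> 0\<close> by (simp add: degree_map_poly coeff_map_poly)
    also have "smult (inverse (lead_coeff (?m q))) (?m q) = R"
      using \<open>q \<noteq> 0\<close> by (subst dec[symmetric], subst smult_smult) (simp add: map_poly_eq_0_iff)
    finally show ?thesis .
  qed
  obtain c q2 where c: "c \<noteq> 0" "map_poly of_int q2 = smult (of_int c) q1"
    using ex_int_multiple_rat_poly by blast
  have "map_poly of_int q2 = (?m (map_poly of_int q2))"
    by (simp add: map_poly_map_poly o_def)
  also have "\<dots> = smult (of_int c) R"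
    by (simp add: c q1 map_poly_smult of_rat_mult)
  finally show ?thesis using c unfolding R_def by blast
qed

section \<open>The covering radius of the lattice\<close>

text \<open>The lattice is complexified because interpolation at the eigenvalues produces
  polynomials with complex coefficients. Taking real parts at the end returns to \<int>^d.\<close>

definition gauss_vec :: "complex^'d \<Rightarrow> bool" where
  "gauss_vec k \<longleftrightarrow> (\<forall>i. Re (k $ i) \<in> \<int> \<and> Im (k $ i) \<in> \<int>)"

lemma gauss_vec_diff: "gauss_vec k \<Longrightarrow> gauss_vec l \<Longrightarrow> gauss_vec (k - l)"
  by (simp add: gauss_vec_def)

lemma gauss_vec_add: "gauss_vec k \<Longrightarrow> gauss_vec l \<Longrightarrow> gauss_vec (k + l)"
  by (simp add: gauss_vec_def)

lemma gauss_vec_0 [simp]: "gauss_vec 0"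
  by (simp add: gauss_vec_def)

lemma gauss_vec_mult: "integral_matrix A \<Longrightarrow> gauss_vec k \<Longrightarrow> gauss_vec (cmat A *v k)"
  by (auto simp: gauss_vec_def integral_matrix_def cmat_def matrix_vector_mult_def intro!: Ints_sum)

lemma gauss_vec_poly_act:
  assumes "integral_matrix A" "gauss_vec k"
  shows "gauss_vec (poly_act (cmat A) (map_poly of_int p) k)"
proof (induction p)
  case (pCons a p)
  have "gauss_vec (of_int a *s k)" using assms(2) by (simp add: gauss_vec_def)
  then show ?case
    using pCons assms(1) by (simp add: map_poly_pCons gauss_vec_add gauss_vec_mult)
qed simp

lemma ex_gauss_vec_near: "\<exists>k. gauss_vec k \<and> norm (y - k) \<le> 2 * CARD('d)" for y :: "complex^'d"
proof (intro exI conjI)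
  let ?k = "\<chi> i. Complex \<lfloor>Re (y $ i)\<rfloor> \<lfloor>Im (y $ i)\<rfloor>"
  show "gauss_vec ?k" by (simp add: gauss_vec_def)
  have "norm ((y - ?k) $ i) \<le> 2" for i
  proof -
    have "norm ((y - ?k) $ i) \<le> \<bar>Re ((y - ?k) $ i)\<bar> + \<bar>Im ((y - ?k) $ i)\<bar>"
      by (rule cmod_le)
    also have "\<dots> \<le> 1 + 1" by (intro add_mono) (auto simp: abs_le_iff; linarith)+
    finally show ?thesis by simp
  qed
  then have "norm (y - ?k) \<le> (\<Sum>i\<in>(UNIV::'d set). 2)"
    unfolding norm_vec_def[of "y - _"] by (intro order_trans[OF L2_set_le_sum] sum_mono) auto
  then show "norm (y - ?k) \<le> 2 * CARD('d)" by simp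
qed

section \<open>Interpolation of inverse powers and the covering bound\<close>

lemma prod_linear_dvd:
  fixes g :: "'a::field poly"
  assumes "finite Z" "\<And>z. z \<in> Z \<Longrightarrow> poly g z = 0"
  shows "(\<Prod>z\<in>Z. [:-z, 1:]) dvd g"
  using assms
proof (induction Z arbitrary: g rule: finite_induct)
  case (insert a Z)
  obtain h where h: "g = [:-a, 1:] * h"
    using insert.prems[of a] by (auto simp: poly_eq_0_iff_dvd)
  have "poly h z = 0" if "z \<in> Z" for z
    using insert.prems[of z] insert.hyps that by (auto simp: h)
  then have "(\<Prod>z\<in>Z. [:-z, 1:]) dvd h" by (rule insert.IH)
  then show ?case
    using insert.hyps by (simp add: h mult_dvd_mono del: mult_pCons_left)
qed simp

text \<open>Lagrange interpolation of the function \<open>z \<mapsto> z\<^sup>-\<^sup>n\<close> on the set \<open>Z\<close> of roots: modulo the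
  polynomial vanishing on \<open>Z\<close>, the inverse powers of \<open>M\<close> are bounded without the polynomial
  factors that Jordan blocks of \<open>M\<close> produce.\<close>
lemma inverse_power_mod_squarefree:
  fixes M :: "complex^'d^'d"
  assumes Z: "finite Z" and lam: "lam > 0" and lower: "\<And>z. z \<in> Z \<Longrightarrow> lam \<le> cmod z"
  shows "\<exists>K\<ge>0. \<forall>n v. \<exists>u s. v = poly_act M ([:0, 1:] ^ n) u - poly_act M (\<Prod>z\<in>Z. [:-z, 1:]) s \<and>
           norm u \<le> K * inverse (lam ^ n) * norm v"
proof -
  \<comment> \<open>The Lagrange basis polynomial of the node \<open>z\<close>. It does not depend
    on n, so one operator bound \<open>K z\<close> serves all exponents.\<close>
  define L where "L z = smult (inverse (\<Prod>w\<in>Z-{z}. z - w)) (\<Prod>w\<in>Z-{z}. [:-w, 1:])" for z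
  have L: "poly (L z) w = of_bool (w = z)" if "z \<in> Z" "w \<in> Z" for z w
    using that Z by (auto simp: L_def poly_prod)
  have "\<forall>z. \<exists>K. K \<ge> 0 \<and> (\<forall>v. norm (poly_act M (L z) v) \<le> K * norm v)"
    using poly_act_bounded[of M] by blast
  from choice[OF this] obtain K where
    K: "\<And>z. K z \<ge> 0" "\<And>z v. norm (poly_act M (L z) v) \<le> K z * norm v"
    by blast
  define h where "h n = (\<Sum>z\<in>Z. smult (inverse (z ^ n)) (L z))" for n
  have "\<exists>u s. v = poly_act M ([:0, 1:] ^ n) u - poly_act M (\<Prod>z\<in>Z. [:-z, 1:]) s \<and>
           norm u \<le> sum K Z * inverse (lam ^ n) * norm v" for n v
  proof -
    \<comment> \<open>\<open>h n\<close> interpolates z^-n, so it inverts X^n modulo the polynomial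
      with root set Z. Evaluated at M, it inverts M^n up to the range of that polynomial in
      M.\<close>
    have "poly ([:0, 1:] ^ n * h n - 1) w = 0" if w: "w \<in> Z" for w
    proof -
      have "poly (h n) w = (\<Sum>z\<in>Z. inverse (z ^ n) * of_bool (w = z))"
        unfolding h_def poly_sum poly_smult using w by (intro sum.cong refl) (simp add: L)
      also have "\<dots> = inverse (w ^ n)" using w Z by (simp add: of_bool_def if_distrib cong: if_cong)
      finally have "poly (h n) w = inverse (w ^ n)" .
      moreover have "w \<noteq> 0" using lower[OF w] lam by auto
      ultimately show ?thesis by (simp add: poly_power)
    qed
    then have "(\<Prod>z\<in>Z. [:-z, 1:]) dvd [:0, 1:] ^ n * h n - 1"
      by (rule prod_linear_dvd[OF Z])
    then obtain g where g: "[:0, 1:] ^ n * h n - 1 = (\<Prod>z\<in>Z. [:-z, 1:]) * g" ..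
    define u where "u = poly_act M (h n) v"
    have "v = poly_act M ([:0, 1:] ^ n) u - poly_act M ([:0, 1:] ^ n * h n - 1) v"
      by (simp add: u_def poly_act_diff poly_act_mult)
    then have v: "v = poly_act M ([:0, 1:] ^ n) u - poly_act M (\<Prod>z\<in>Z. [:-z, 1:]) (poly_act M g v)"
      unfolding g poly_act_mult .
    have "norm u \<le> (\<Sum>z\<in>Z. norm (inverse (z ^ n) *s poly_act M (L z) v))"
      unfolding u_def h_def poly_act_sum poly_act_smult by (rule norm_sum)
    also have "\<dots> \<le> (\<Sum>z\<in>Z. inverse (lam ^ n) * (K z * norm v))"
    proof (intro sum_mono)
      fix z assume z: "z \<in> Z"
      have "norm (inverse (z ^ n) *s poly_act M (L z) v) = inverse (cmod z ^ n) * norm (poly_act M (L z) v)"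
        by (simp add: norm_vec_def norm_mult L2_set_right_distrib norm_inverse norm_power)
      also have "\<dots> \<le> inverse (lam ^ n) * (K z * norm v)"
        using lam lower[OF z] K by (intro mult_mono le_imp_inverse_le power_mono) auto
      finally show "norm (inverse (z ^ n) *s poly_act M (L z) v) \<le> inverse (lam ^ n) * (K z * norm v)" .
    qed
    also have "\<dots> = sum K Z * inverse (lam ^ n) * norm v"
      by (simp add: sum_distrib_left sum_distrib_right mult_ac)
    finally show ?thesis using v by blast
  qed
  moreover have "sum K Z \<ge> 0" using K by (simp add: sum_nonneg)
  ultimately show ?thesis by blast
qed

lemma cmat_power_Re:
  "(\<chi> i. Re (((((*v) (cmat A)) ^^ n) w) $ i)) = (((*v) A) ^^ n) (\<chi> i. Re (w $ i))"
proof (induction n)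
  case (Suc n)
  then show ?case
    by (simp add: vec_eq_iff matrix_vector_mult_def cmat_def)
qed simp

text \<open>The lattice \<open>A\<^sup>-\<^sup>n\<int>\<^sup>d\<close> has covering radius \<open>O(\<lambda>\<^sup>-\<^sup>n)\<close> although \<open>\<parallel>A\<^sup>-\<^sup>n\<parallel>\<close> need not be \<open>O(\<lambda>\<^sup>-\<^sup>n)\<close>:
  let \<open>Q = q(A)\<close> for an integral multiple \<open>q\<close> of the squarefree part of the characteristic polynomial.
  Then \<open>Q\<close> is nilpotent, preserves \<open>\<int>\<^sup>d\<close>, and \<open>A\<^sup>-\<^sup>n\<close> is \<open>O(\<lambda>\<^sup>-\<^sup>n)\<close> modulo the range of \<open>Q\<close>, so one can
  approximate successively along the ranges of \<open>Q\<^sup>j\<close>.\<close>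
lemma lattice_covering_radius:
  fixes A :: "real^'d^'d"
  assumes int: "integral_matrix A" and exp: "expanding A"
    and ex: "\<exists>z. eigenvalue A z \<and> cmod z = lam"
    and lower: "\<forall>z. eigenvalue A z \<longrightarrow> lam \<le> cmod z"
  shows "\<exists>C>0. \<forall>n y. \<exists>m w. int_vec m \<and> y - m = (((*v) A) ^^ n) w \<and> norm w \<le> C * inverse (lam ^ n)"
proof -
  have lam: "lam > 1" using exp ex by (auto simp: expanding_def)
  let ?M = "cmat A"
  obtain P :: "int poly" where P: "\<And>z. poly (map_poly of_int P) z = det (?M - mat z)"
    using ex_int_charpoly[OF int] by blast
  have P_root: "poly (map_poly of_int P) z = 0 \<longleftrightarrow> eigenvalue A z" for z
    by (simp add: P eigenvalue_def)
  have "\<not> eigenvalue A 0" using exp by (auto simp: expanding_def)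
  then have "map_poly of_int P \<noteq> (0 :: complex poly)" using P_root[of 0] by auto
  moreover obtain z0 where "poly (map_poly of_int P) z0 = (0 :: complex)" using ex P_root by blast
  ultimately have "degree (map_poly of_int P :: complex poly) > 0"
    by (metis degree_eq_zeroE gr0I mult_zero_right pCons_0_0 poly_pCons poly_0 add.right_neutral)
  then have deg: "degree P > 0" by (simp add: degree_map_poly)
  define Z where "Z = {z. poly (map_poly of_int P) z = (0::complex)}"
  have Z: "finite Z"
    unfolding Z_def using \<open>map_poly of_int P \<noteq> 0\<close> by (rule poly_roots_finite)
  obtain c and q :: "int poly" where c: "c \<noteq> 0"
    and q: "map_poly of_int q = smult (of_int c) (\<Prod>z\<in>Z. [:-z, 1 :: complex:])"
    using ex_int_squarefree_part[OF deg] unfolding Z_def by blast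
  define R where "R = (\<Prod>z\<in>Z. [:-z, 1 :: complex:])"
  define S where "S = (map_poly of_int q :: complex poly)"
  have SR: "S = smult (of_int c) R" by (simp add: S_def R_def q)
  obtain p where p: "p \<noteq> 0" "\<And>v. poly_act ?M p v = 0" "\<And>z. poly p z = 0 \<Longrightarrow> det (?M - mat z) = 0"
    using ex_annihilating_poly_roots[of ?M] by blast
  define N where "N = degree p"
  \<comment> \<open>Every root of p is an eigenvalue and hence a root of S, so p divides S^(deg p).
    This is why S becomes nilpotent at M, and where \<open>N\<close> comes from.\<close>
  have "poly S z = 0" if "poly p z = 0" for z
  proof -
    have "z \<in> Z" using p(3)[OF that] P by (simp add: Z_def)
    then show ?thesis using Z by (auto simp: SR R_def poly_prod)
  qed
  then have "p dvd S ^ N"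
    using nullstellensatz_univariate[of p S] p(1) by (auto simp: N_def)
  then have nil: "poly_act ?M (S ^ N) v = 0" for v
    using p(2) by (metis dvdE poly_act_mult mult.commute poly_act_vec_0)
  obtain K where K: "K \<ge> 0" and step: "\<And>n v. \<exists>u s. v = poly_act ?M ([:0, 1:] ^ n) u - poly_act ?M R s \<and>
           norm u \<le> K * inverse (lam ^ n) * norm v"
    using inverse_power_mod_squarefree[OF Z, of lam ?M] lam lower P_root unfolding R_def Z_def by force
  \<comment> \<open>The case j = 0 concerns the range of S^N, which is zero; the case j = N is the
    whole space.\<close>
  have "\<exists>C\<ge>0. \<forall>n y. \<exists>m w. gauss_vec m \<and>
      poly_act ?M (S ^ (N - j)) y - m = poly_act ?M ([:0, 1:] ^ n) w \<and> norm w \<le> C * inverse (lam ^ n)"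
    if "j \<le> N" for j
    using that
  proof (induction j)
    case 0
    show ?case
      by (intro exI[of _ 0] conjI allI) (auto simp: nil)
  next
    case (Suc j)
    define i where "i = N - Suc j"
    have i: "N - j = Suc i" using Suc.prems by (simp add: i_def)
    obtain C where C: "C \<ge> 0" and IH: "\<And>n y. \<exists>m w. gauss_vec m \<and>
      poly_act ?M (S ^ Suc i) y - m = poly_act ?M ([:0, 1:] ^ n) w \<and> norm w \<le> C * inverse (lam ^ n)"
      using Suc.IH Suc.prems i by auto
    obtain B where B: "B \<ge> 0" "\<And>v. norm (poly_act ?M (S ^ i) v) \<le> B * norm v"
      using poly_act_bounded by blast
    \<comment> \<open>The first summand bounds S^i applied to the interpolation output for a
      rounding error of norm at most 2d; the second comes from the smaller range.\<close>
    define C' where "C' = B * K * (2 * CARD('d)) + C"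
    have "\<exists>m w. gauss_vec m \<and>
      poly_act ?M (S ^ i) y - m = poly_act ?M ([:0, 1:] ^ n) w \<and> norm w \<le> C' * inverse (lam ^ n)" for n y
    proof -
      \<comment> \<open>Rounding precedes interpolation, so that the bound does not depend on
        \<open>y\<close>.\<close>
      obtain k where k: "gauss_vec k" "norm (y - k) \<le> 2 * CARD('d)"
        using ex_gauss_vec_near by blast
      obtain u s where us: "y - k = poly_act ?M ([:0, 1:] ^ n) u - poly_act ?M R s"
          "norm u \<le> K * inverse (lam ^ n) * norm (y - k)"
        using step by blast
      define t where "t = inverse (of_int c) *s s"
      have "poly_act ?M S t = poly_act ?M R s"
        using c by (simp add: SR t_def poly_act_smult poly_act_vec_scale)
      then have eq: "y - k = poly_act ?M ([:0, 1:] ^ n) u - poly_act ?M S t" using us by simp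
      obtain m w where m: "gauss_vec m"
        "poly_act ?M (S ^ Suc i) t - m = poly_act ?M ([:0, 1:] ^ n) w" "norm w \<le> C * inverse (lam ^ n)"
        using IH by blast
      \<comment> \<open>Applying S^i turns the remainder S t into S^(i+1) t, which the induction
        hypothesis trades for the lattice vector \<open>m\<close> plus M^n \<open>w\<close> with
        \<open>w\<close> short.\<close>
      have "poly_act ?M (S ^ i) y - poly_act ?M (S ^ i) k = poly_act ?M (S ^ i) (y - k)"
        by (simp add: poly_act_vec_diff)
      also have "\<dots> = poly_act ?M ([:0, 1:] ^ n) (poly_act ?M (S ^ i) u) - poly_act ?M (S ^ Suc i) t"
        unfolding eq poly_act_vec_diff
        by (simp add: poly_act_commute[of ?M "S ^ i"] poly_act_mult power_Suc2 del: power_Suc)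
      finally have "poly_act ?M (S ^ i) y - (poly_act ?M (S ^ i) k - m) =
          poly_act ?M ([:0, 1:] ^ n) (poly_act ?M (S ^ i) u - w)"
        using m(2) by (simp add: poly_act_vec_diff algebra_simps)
      moreover have "gauss_vec (poly_act ?M (S ^ i) k - m)"
      proof -
        have "gauss_vec (poly_act ?M (S ^ i) k)"
          by (induction i) (simp_all add: poly_act_mult k S_def gauss_vec_poly_act int)
        then show ?thesis using m(1) by (rule gauss_vec_diff)
      qed
      moreover have "norm (poly_act ?M (S ^ i) u - w) \<le> C' * inverse (lam ^ n)"
      proof -
        have "norm u \<le> K * inverse (lam ^ n) * (2 * CARD('d))"
          using us(2) k(2) K lam by (smt (verit) inverse_nonnegative_iff_nonnegative mult_left_mono mult_nonneg_nonneg zero_le_power)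
        then have "B * norm u \<le> B * (K * inverse (lam ^ n) * (2 * CARD('d)))"
          using B(1) by (rule mult_left_mono)
        then have "norm (poly_act ?M (S ^ i) u) \<le> B * K * (2 * CARD('d)) * inverse (lam ^ n)"
          using B(2)[of u] by (simp add: mult_ac)
        moreover have "norm (poly_act ?M (S ^ i) u - w) \<le> norm (poly_act ?M (S ^ i) u) + norm w"
          by (rule norm_triangle_ineq4)
        ultimately show ?thesis using m(3) by (simp add: C'_def distrib_right)
      qed
      ultimately show ?thesis by blast
    qed
    moreover have "C' \<ge> 0" using B K C by (simp add: C'_def)
    ultimately show ?case unfolding i_def by blast
  qed
  from this[of N] obtain C where C: "C \<ge> 0" and cov: "\<And>n y. \<exists>m w. gauss_vec m \<and>
      y - m = poly_act ?M ([:0, 1:] ^ n) w \<and> norm w \<le> C * inverse (lam ^ n)"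
    by auto
  \<comment> \<open>Since A and y are real, the real parts of the complex \<open>m\<close> and
    \<open>w\<close> serve. The added 1 makes the constant positive.\<close>
  have "\<exists>m w. int_vec m \<and> y - m = (((*v) A) ^^ n) w \<and> norm w \<le> (C + 1) * inverse (lam ^ n)" for n y
  proof -
    obtain m w where m: "gauss_vec m" "(\<chi> i. complex_of_real (y $ i)) - m = (((*v) ?M) ^^ n) w"
      "norm w \<le> C * inverse (lam ^ n)"
      using cov[of "\<chi> i. complex_of_real (y $ i)" n] by (auto simp: poly_act_X_power)
    have "int_vec (\<chi> i. Re (m $ i))" using m(1) by (simp add: int_vec_def gauss_vec_def)
    moreover have "y - (\<chi> i. Re (m $ i)) = (((*v) A) ^^ n) (\<chi> i. Re (w $ i))"
      unfolding cmat_power_Re[symmetric] m(2)[symmetric] by (simp add: vec_eq_iff)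
    moreover have "norm (\<chi> i. Re (w $ i)) \<le> norm w"
      unfolding norm_vec_def by (intro L2_set_mono) (auto simp: abs_Re_le_cmod)
    moreover have "C * inverse (lam ^ n) \<le> (C + 1) * inverse (lam ^ n)"
      using lam by (intro mult_right_mono) auto
    ultimately show ?thesis using m(3) by (meson order_trans)
  qed
  then show ?thesis using C by (intro exI[of _ "C + 1"]) auto
qed

section \<open>Integration over the unit cell\<close>

text \<open>Half-open, so that the integer translates tile space exactly; the closed cube of
  \<open>torus_measure\<close> differs from it by a null set.\<close>

definition unit_cell :: "(real^'d) set" where
  "unit_cell = {x. \<forall>i. 0 \<le> x $ i \<and> x $ i < 1}"

text \<open>A Borel measure on all of space, so that periodic functions and their compositions with
  affine maps are integrated without restricting them to a domain.\<close>

definition cell_measure :: "(real^'d) measure" where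
  "cell_measure = density lborel (indicator unit_cell)"

definition vfrac :: "real^'d \<Rightarrow> real^'d" where
  "vfrac x = (\<chi> i. frac (x $ i))"

text \<open>Polymorphic in the values, because invariance is first proved for
  \<open>ennreal\<close>-valued functions, where integrability is no issue.\<close>

definition zperiodic :: "(real^'d \<Rightarrow> 'a) \<Rightarrow> bool" where
  "zperiodic h \<longleftrightarrow> (\<forall>x k. int_vec k \<longrightarrow> h (x + k) = h x)"

lemma zperiodicD: "zperiodic h \<Longrightarrow> int_vec k \<Longrightarrow> h (x + k) = h x"
  by (simp add: zperiodic_def)

lemma int_vec_add: "int_vec k \<Longrightarrow> int_vec l \<Longrightarrow> int_vec (k + l)"
  and int_vec_diff: "int_vec k \<Longrightarrow> int_vec l \<Longrightarrow> int_vec (k - l)"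
  and int_vec_uminus: "int_vec k \<Longrightarrow> int_vec (- k)"
  and int_vec_0 [simp]: "int_vec 0"
  by (simp_all add: int_vec_def)

lemma int_vec_mult: "integral_matrix B \<Longrightarrow> int_vec k \<Longrightarrow> int_vec (B *v k)"
  by (auto simp: int_vec_def integral_matrix_def matrix_vector_mult_def intro!: Ints_sum Ints_mult)

lemma countable_int_vec: "countable {k :: real^'d. int_vec k}"
proof -
  have "{k :: real^'d. int_vec k} \<subseteq> range (\<lambda>f. \<chi> i. of_int (f i))"
  proof safe
    fix k :: "real^'d" assume "int_vec k"
    then have "k = (\<chi> i. of_int \<lfloor>k $ i\<rfloor>)"
      by (auto simp: int_vec_def vec_eq_iff elim!: Ints_cases)
    then show "k \<in> range (\<lambda>f. \<chi> i. of_int (f i))" by (metis rangeI)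
  qed
  then show ?thesis by (rule countable_subset) auto
qed

lemma vfrac_in_cell: "vfrac x \<in> unit_cell"
  by (simp add: vfrac_def unit_cell_def frac_lt_1)

lemma vfrac_cell: "x \<in> unit_cell \<Longrightarrow> vfrac x = x"
  by (simp add: vfrac_def unit_cell_def vec_eq_iff frac_eq)

lemma int_vec_vfrac_diff: "int_vec (vfrac x - x)"
  by (simp add: vfrac_def int_vec_def frac_def)

lemma zperiodic_vfrac: "zperiodic h \<Longrightarrow> h (vfrac x) = h x"
  using zperiodicD[of h "vfrac x - x" x] int_vec_vfrac_diff[of x] by simp

lemma zperiodic_comp_vfrac: "zperiodic (\<lambda>x. h (vfrac x))"
proof -
  have "vfrac (x + k) = vfrac x" if "int_vec k" for x k :: "real^'a"
    using that by (auto simp: vfrac_def vec_eq_iff int_vec_def frac_def elim!: Ints_cases)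
  then show ?thesis by (simp add: zperiodic_def)
qed

lemma ex1_cell_translate: "\<exists>!k. int_vec k \<and> x + k \<in> unit_cell"
proof (rule ex1I[of _ "vfrac x - x"])
  show "int_vec (vfrac x - x) \<and> x + (vfrac x - x) \<in> unit_cell"
    by (simp add: int_vec_vfrac_diff vfrac_in_cell)
next
  fix k assume k: "int_vec k \<and> x + k \<in> unit_cell"
  then have "vfrac (x + k) = x + k" by (simp add: vfrac_cell)
  moreover have "vfrac (x + k) = vfrac x"
    using zperiodicD[OF zperiodic_comp_vfrac[of "\<lambda>y. y"], of k x] k by simp
  ultimately show "k = vfrac x - x" by simp
qed

lemma borel_measurable_vfrac [measurable]: "(vfrac :: real^'d \<Rightarrow> _) \<in> borel_measurable borel"
  by (auto simp: borel_measurable_euclidean_space[where 'c = "real^'d"] Basis_vec_def inner_axis vfrac_def frac_def)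

lemma unit_cell_borel [measurable]: "(unit_cell :: (real^'d) set) \<in> sets borel"
proof -
  have "unit_cell = {x :: real^'d. vfrac x = x}"
    by (auto simp: vfrac_cell) (metis vfrac_in_cell)
  also have "\<dots> \<in> sets borel" by measurable
  finally show ?thesis .
qed

lemma sets_cell_measure [measurable_cong, simp]: "sets cell_measure = sets borel"
  by (simp add: cell_measure_def)

lemma space_cell_measure [simp]: "space cell_measure = UNIV"
  by (simp add: cell_measure_def)

lemma nn_integral_cell:
  "h \<in> borel_measurable borel \<Longrightarrow> (\<integral>\<^sup>+x. h x \<partial>cell_measure) = (\<integral>\<^sup>+x. indicator unit_cell x * h x \<partial>lborel)"
  unfolding cell_measure_def by (rule nn_integral_density) auto

lemma AE_cell_measure: "AE x in cell_measure. x \<in> unit_cell"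
  unfolding cell_measure_def by (subst AE_density) (auto simp: indicator_def)

lemma sum_Basis_nth: "(\<Sum>x\<in>(Basis :: (real^'d) set). x $ i) = 1"
  by (simp add: cart_eq_inner_axis inner_Basis axis_in_Basis_iff if_distrib cong: if_cong)

lemma emeasure_unit_cell: "emeasure lborel (unit_cell :: (real^'d) set) = 1"
proof -
  have b: "emeasure lborel (box 0 One :: (real^'d) set) = 1"
    "emeasure lborel (cbox 0 One :: (real^'d) set) = 1"
    by (simp_all add: emeasure_lborel_box_eq emeasure_lborel_cbox_eq)
  have "box 0 One \<subseteq> (unit_cell :: (real^'d) set)" "(unit_cell :: (real^'d) set) \<subseteq> cbox 0 One"
    by (auto simp: unit_cell_def mem_box_cart sum_Basis_nth less_imp_le)
  then have "emeasure lborel (box 0 One :: (real^'d) set) \<le> emeasure lborel (unit_cell :: (real^'d) set)"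
    "emeasure lborel (unit_cell :: (real^'d) set) \<le> emeasure lborel (cbox 0 One :: (real^'d) set)"
    by (intro emeasure_mono; simp)+
  then show ?thesis unfolding b by simp
qed

interpretation cell: prob_space cell_measure
  by (rule prob_spaceI) (simp add: cell_measure_def emeasure_density emeasure_unit_cell)

lemma nn_integral_lborel_translate:
  fixes h :: "'a::euclidean_space \<Rightarrow> ennreal"
  assumes [measurable]: "h \<in> borel_measurable borel"
  shows "(\<integral>\<^sup>+x. h (x + a) \<partial>lborel) = (\<integral>\<^sup>+x. h x \<partial>lborel)"
proof -
  have "(\<integral>\<^sup>+x. h x \<partial>lborel) = (\<integral>\<^sup>+x. h x \<partial>distr lborel borel ((+) a))"
    by (simp add: lborel_distr_plus)
  also have "\<dots> = (\<integral>\<^sup>+x. h (x + a) \<partial>lborel)"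
    by (subst nn_integral_distr) (simp_all add: add.commute)
  finally show ?thesis ..
qed

text \<open>Lattice sums are written as integrals over a counting measure, so that exchanging them
  with integrals is Tonelli. Here such a sum collapses because exactly one translate hits the
  cell.\<close>

lemma nn_integral_count_space_ex1:
  assumes "\<exists>!k. k \<in> I \<and> P k"
  shows "(\<integral>\<^sup>+k. of_bool (P k) * c \<partial>count_space I) = c"
proof -
  define k where "k = (THE k. k \<in> I \<and> P k)"
  have k: "k \<in> I \<and> P k" unfolding k_def by (rule theI'[OF assms])
  have uniq: "l = k" if "l \<in> I" "P l" for l
    unfolding k_def by (rule the1_equality[OF assms, symmetric]) (use that in blast)
  have "(\<integral>\<^sup>+l. of_bool (P l) * c \<partial>count_space I) = (\<integral>\<^sup>+l. c * indicator {k} l \<partial>count_space I)"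
  proof (rule nn_integral_cong)
    fix l assume "l \<in> space (count_space I)"
    then have "P l \<longleftrightarrow> l = k" using k uniq[of l] by auto
    then show "of_bool (P l) * c = c * indicator {k} l" by simp
  qed
  also have "\<dots> = c" using k by (simp add: nn_integral_cmult_indicator)
  finally show ?thesis .
qed

lemma borel_measurable_countable_sum:
  fixes f :: "'i \<Rightarrow> 'b \<Rightarrow> ennreal"
  assumes "countable I" and "\<And>i. i \<in> I \<Longrightarrow> f i \<in> borel_measurable M"
  shows "(\<lambda>x. \<integral>\<^sup>+i. f i x \<partial>count_space I) \<in> borel_measurable M"
proof -
  interpret sigma_finite_measure "count_space I"
    by (rule sigma_finite_measure_count_space_countable) fact
  have "(\<lambda>(x, i). f i x) \<in> borel_measurable (M \<Otimes>\<^sub>M count_space I)"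
    by (subst measurable_pair_swap_iff, rule measurable_pair_measure_countable1) (use assms in auto)
  then show ?thesis by (rule borel_measurable_nn_integral)
qed

text \<open>Insert 1 as the sum over k of the indicators of the translated cells, exchange sum and
  integral, and shift each summand back by k.\<close>

lemma nn_integral_cell_unfold:
  fixes h :: "real^'d \<Rightarrow> ennreal"
  assumes [measurable]: "h \<in> borel_measurable borel"
  shows "(\<integral>\<^sup>+x. h x \<partial>lborel) = (\<integral>\<^sup>+x. (\<integral>\<^sup>+k. h (x + k) \<partial>count_space {k. int_vec k}) \<partial>cell_measure)"
proof -
  have [measurable]: "(\<lambda>x. \<integral>\<^sup>+k. h (x + k) \<partial>count_space {k. int_vec k}) \<in> borel_measurable borel"
    by (rule borel_measurable_countable_sum) (auto simp: countable_int_vec)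
  have ex1: "\<exists>!k. k \<in> {k. int_vec k} \<and> x - k \<in> unit_cell" for x :: "real^'d"
  proof -
    obtain k where k: "int_vec k" "x + k \<in> unit_cell" "\<And>l. int_vec l \<and> x + l \<in> unit_cell \<Longrightarrow> l = k"
      using ex1_cell_translate[of x] by blast
    show ?thesis
    proof (rule ex1I[of _ "- k"])
      show "- k \<in> {k. int_vec k} \<and> x - - k \<in> unit_cell"
        using k(1,2) int_vec_uminus by simp
    next
      fix l :: "real^'d" assume "l \<in> {k. int_vec k} \<and> x - l \<in> unit_cell"
      then have "int_vec (- l) \<and> x + - l \<in> unit_cell" by (simp add: int_vec_def)
      then have "- l = k" by (rule k(3))
      then show "l = - k" by (metis minus_minus)
    qed
  qed
  have "(\<integral>\<^sup>+x. h x \<partial>lborel) =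
      (\<integral>\<^sup>+x. (\<integral>\<^sup>+k. indicator unit_cell (x + - k) * h (x + - k + k) \<partial>count_space {k. int_vec k}) \<partial>lborel)"
    using nn_integral_count_space_ex1[OF ex1] by (simp add: indicator_def of_bool_def)
  also have "\<dots> = (\<integral>\<^sup>+k. (\<integral>\<^sup>+x. indicator unit_cell (x + - k) * h (x + - k + k) \<partial>lborel) \<partial>count_space {k. int_vec k})"
    by (rule nn_integral_count_space_nn_integral[OF countable_int_vec]) simp
  also have "\<dots> = (\<integral>\<^sup>+k. (\<integral>\<^sup>+x. indicator unit_cell x * h (x + k) \<partial>lborel) \<partial>count_space {k. int_vec k})"
  proof (rule nn_integral_cong)
    fix k :: "real^'d"
    show "(\<integral>\<^sup>+x. indicator unit_cell (x + - k) * h (x + - k + k) \<partial>lborel) =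
          (\<integral>\<^sup>+x. indicator unit_cell x * h (x + k) \<partial>lborel)"
      by (rule nn_integral_lborel_translate[where h = "\<lambda>x. indicator unit_cell x * h (x + k)"]) simp
  qed
  also have "\<dots> = (\<integral>\<^sup>+x. (\<integral>\<^sup>+k. indicator unit_cell x * h (x + k) \<partial>count_space {k. int_vec k}) \<partial>lborel)"
    by (rule nn_integral_count_space_nn_integral[OF countable_int_vec, symmetric]) simp
  also have "\<dots> = (\<integral>\<^sup>+x. (\<integral>\<^sup>+k. h (x + k) \<partial>count_space {k. int_vec k}) \<partial>cell_measure)"
    by (simp add: nn_integral_cell nn_integral_cmult)
  finally show ?thesis .
qed

text \<open>The shifted cell is another fundamental domain: after unfolding, each x has exactly one
  integer translate in it, and h takes the same value at all of them.\<close>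

lemma nn_integral_cell_translate:
  fixes h :: "real^'d \<Rightarrow> ennreal"
  assumes [measurable]: "h \<in> borel_measurable borel" and per: "zperiodic h"
  shows "(\<integral>\<^sup>+x. h (x + v) \<partial>cell_measure) = (\<integral>\<^sup>+x. h x \<partial>cell_measure)"
proof -
  have "(\<integral>\<^sup>+x. h (x + v) \<partial>cell_measure) = (\<integral>\<^sup>+x. indicator unit_cell (x + v - v) * h (x + v) \<partial>lborel)"
    by (simp add: nn_integral_cell)
  also have "\<dots> = (\<integral>\<^sup>+x. indicator unit_cell (x - v) * h x \<partial>lborel)"
    by (rule nn_integral_lborel_translate[where h = "\<lambda>x. indicator unit_cell (x - v) * h x"]) simp
  also have "\<dots> = (\<integral>\<^sup>+x. (\<integral>\<^sup>+k. indicator unit_cell (x + k - v) * h (x + k) \<partial>count_space {k. int_vec k}) \<partial>cell_measure)"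
    by (rule nn_integral_cell_unfold) simp
  also have "\<dots> = (\<integral>\<^sup>+x. (\<integral>\<^sup>+k. of_bool (x - v + k \<in> unit_cell) * h x \<partial>count_space {k. int_vec k}) \<partial>cell_measure)"
    by (intro nn_integral_cong) (simp add: zperiodicD[OF per] indicator_def of_bool_def algebra_simps)
  also have "\<dots> = (\<integral>\<^sup>+x. h x \<partial>cell_measure)"
    using ex1_cell_translate[of "_ - v"] by (simp add: nn_integral_count_space_ex1)
  finally show ?thesis .
qed

lemma matrix_inv_mult:
  fixes B :: "real^'d^'d"
  assumes "det B \<noteq> 0"
  shows "B *v (matrix_inv B *v x) = x" and "matrix_inv B *v (B *v x) = x"
proof -
  have "invertible B" using assms by (simp add: invertible_det_nz)
  then have "B ** matrix_inv B = mat 1 \<and> matrix_inv B ** B = mat 1"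
    unfolding invertible_def matrix_inv_def by (rule someI_ex)
  then show "B *v (matrix_inv B *v x) = x" "matrix_inv B *v (B *v x) = x"
    by (simp_all add: matrix_vector_mul_assoc)
qed

lemma borel_measurable_matrix_mult [measurable]:
  fixes B :: "real^'n^'m"
  shows "(*v) B \<in> borel_measurable borel"
  by (intro borel_measurable_continuous_onI linear_continuous_on) simp

text \<open>The pull-back \<open>h \<circ> B\<close> is invariant under all translations by \<open>B\<^sup>-\<^sup>1w\<close>; averaging over \<open>w\<close>
  replaces \<open>h\<close> by its mean.\<close>
lemma nn_integral_cell_endomorphism:
  fixes h :: "real^'d \<Rightarrow> ennreal" and B :: "real^'d^'d"
  assumes [measurable]: "h \<in> borel_measurable borel" and per: "zperiodic h"
    and B: "integral_matrix B" "det B \<noteq> 0"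
  shows "(\<integral>\<^sup>+x. h (B *v x) \<partial>cell_measure) = (\<integral>\<^sup>+x. h x \<partial>cell_measure)"
proof -
  interpret P: pair_sigma_finite "cell_measure :: (real^'d) measure" "cell_measure :: (real^'d) measure" ..
  have perB: "zperiodic (\<lambda>x. h (B *v x))"
    using B per by (auto simp: zperiodic_def matrix_vector_right_distrib int_vec_mult)
  have shift: "(\<integral>\<^sup>+x. h (B *v x + w) \<partial>cell_measure) = (\<integral>\<^sup>+x. h (B *v x) \<partial>cell_measure)" for w
    using nn_integral_cell_translate[OF _ perB, of "matrix_inv B *v w"] B(2)
    by (simp add: matrix_vector_right_distrib matrix_inv_mult)
  have "(\<integral>\<^sup>+x. h (B *v x) \<partial>cell_measure) = (\<integral>\<^sup>+w. (\<integral>\<^sup>+x. h (B *v x) \<partial>cell_measure) \<partial>(cell_measure :: (real^'d) measure))"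
    by (simp add: cell.emeasure_space_1[simplified])
  also have "\<dots> = (\<integral>\<^sup>+w. (\<integral>\<^sup>+x. h (w + B *v x) \<partial>cell_measure) \<partial>cell_measure)"
  proof (rule nn_integral_cong)
    fix w
    show "(\<integral>\<^sup>+x. h (B *v x) \<partial>cell_measure) = (\<integral>\<^sup>+x. h (w + B *v x) \<partial>cell_measure)"
      using shift[of w] by (simp add: add.commute)
  qed
  also have "\<dots> = (\<integral>\<^sup>+x. (\<integral>\<^sup>+w. h (w + B *v x) \<partial>cell_measure) \<partial>cell_measure)"
    by (rule P.Fubini') simp
  also have "\<dots> = (\<integral>\<^sup>+x. h x \<partial>cell_measure)"
    by (simp add: nn_integral_cell_translate[OF _ per] cell.emeasure_space_1[simplified])
  finally show ?thesis .
qed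

section \<open>Linear images and the number of digits\<close>

text \<open>B permutes \<int>^d, hence periodizing h commutes with composing by B, and on the torus
  B preserves the measure. No determinant formula is involved, so this can feed the proof of
  one.\<close>

lemma nn_integral_unimodular:
  fixes h :: "real^'d \<Rightarrow> ennreal" and B :: "real^'d^'d"
  assumes [measurable]: "h \<in> borel_measurable borel" and B: "integral_matrix B" "det B \<noteq> 0"
    and inv: "\<And>k. int_vec k \<Longrightarrow> int_vec (matrix_inv B *v k)"
  shows "(\<integral>\<^sup>+x. h (B *v x) \<partial>lborel) = (\<integral>\<^sup>+x. h x \<partial>lborel)"
proof -
  define H where "H x = (\<integral>\<^sup>+k. h (x + k) \<partial>count_space {k. int_vec k})" for x
  have [measurable]: "H \<in> borel_measurable borel"
    unfolding H_def by (rule borel_measurable_countable_sum) (auto simp: countable_int_vec)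
  have bij: "bij_betw ((*v) B) {k. int_vec k} {k. int_vec k}"
    by (rule bij_betwI[of _ _ _ "(*v) (matrix_inv B)"]) (auto simp: int_vec_mult B inv matrix_inv_mult)
  have perH: "zperiodic H"
    unfolding zperiodic_def
  proof safe
    fix x k :: "real^'d" assume k: "int_vec k"
    have "bij_betw ((+) k) {k. int_vec k} {k. int_vec k}"
      by (rule bij_betwI[of _ _ _ "\<lambda>x. x - k"]) (auto simp: int_vec_add int_vec_diff k)
    from nn_integral_bij_count_space[OF this, of "\<lambda>l. h (x + l)"]
    show "H (x + k) = H x" by (simp add: H_def add.assoc)
  qed
  have "(\<integral>\<^sup>+x. h (B *v x) \<partial>lborel) =
      (\<integral>\<^sup>+x. (\<integral>\<^sup>+k. h (B *v (x + k)) \<partial>count_space {k. int_vec k}) \<partial>cell_measure)"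
    by (rule nn_integral_cell_unfold) simp
  also have "\<dots> = (\<integral>\<^sup>+x. H (B *v x) \<partial>cell_measure)"
  proof (rule nn_integral_cong)
    fix x
    show "(\<integral>\<^sup>+k. h (B *v (x + k)) \<partial>count_space {k. int_vec k}) = H (B *v x)"
      using nn_integral_bij_count_space[OF bij, of "\<lambda>l. h (B *v x + l)"]
      by (simp add: H_def matrix_vector_right_distrib)
  qed
  also have "\<dots> = (\<integral>\<^sup>+x. H x \<partial>cell_measure)"
    by (rule nn_integral_cell_endomorphism) (use perH B in auto)
  also have "\<dots> = (\<integral>\<^sup>+x. h x \<partial>lborel)"
    unfolding H_def by (rule nn_integral_cell_unfold[symmetric]) simp
  finally show ?thesis .
qed

lemma det_in_Ints: "integral_matrix B \<Longrightarrow> det B \<in> \<int>"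
  by (auto simp: det_def integral_matrix_def intro!: Ints_sum Ints_mult Ints_prod)

lemma integral_matrixI:
  assumes "linear f" "\<And>k. int_vec k \<Longrightarrow> int_vec (f k)"
  shows "integral_matrix (matrix f)"
proof -
  have "int_vec (f (axis j 1))" for j
    by (rule assms(2)) (simp add: int_vec_def axis_def)
  then show ?thesis
    by (simp add: integral_matrix_def matrix_def int_vec_def)
qed

lemma abs_det_unimodular:
  fixes f g :: "real^'d \<Rightarrow> real^'d"
  assumes f: "linear f" "\<And>k. int_vec k \<Longrightarrow> int_vec (f k)"
    and g: "linear g" "\<And>k. int_vec k \<Longrightarrow> int_vec (g k)"
    and fg: "\<And>x. f (g x) = x"
  shows "\<bar>det (matrix f)\<bar> = 1"
proof -
  have "matrix f ** matrix g = mat 1"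
    using matrix_compose[OF g(1) f(1)] fg by (simp add: o_def flip: matrix_id_mat_1 id_def)
  then have 1: "\<bar>det (matrix f)\<bar> * \<bar>det (matrix g)\<bar> = 1"
    by (metis abs_mult abs_one det_I det_mul)
  obtain a b where "det (matrix f) = of_int a" "det (matrix g) = of_int b"
    using det_in_Ints integral_matrixI f g by (metis Ints_cases)
  with 1 have "real_of_int (\<bar>a\<bar> * \<bar>b\<bar>) = of_int 1" by simp
  then have "\<bar>a\<bar> * \<bar>b\<bar> = 1" by (simp only: of_int_eq_iff)
  then have "\<bar>a\<bar> = 1" by (auto simp: zmult_eq_1_iff)
  then show ?thesis using \<open>det (matrix f) = of_int a\<close> by simp
qed

text \<open>The library's \<open>measure_linear_image\<close> requires a well-ordered index type. The elementary swaps and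
  shears are unimodular, so they are covered by the invariance of the cell measure; only diagonal maps
  need a computation.\<close>
lemma nn_integral_linear:
  fixes f :: "real^'d \<Rightarrow> real^'d"
  assumes "linear f"
  shows "det (matrix f) \<noteq> 0 \<longrightarrow> (\<forall>h\<in>borel_measurable borel.
    ennreal \<bar>det (matrix f)\<bar> * (\<integral>\<^sup>+x. h (f x) \<partial>lborel) = (\<integral>\<^sup>+x. h x \<partial>lborel))"
proof -
  let ?P = "\<lambda>f :: real^'d \<Rightarrow> real^'d. det (matrix f) \<noteq> 0 \<longrightarrow> (\<forall>h\<in>borel_measurable borel.
    ennreal \<bar>det (matrix f)\<bar> * (\<integral>\<^sup>+x. h (f x) \<partial>lborel) = (\<integral>\<^sup>+x. h x \<partial>lborel))"
  have meas: "f \<in> borel_measurable borel" if "linear f" for f :: "real^'d \<Rightarrow> real^'d"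
    using that by (intro borel_measurable_continuous_onI linear_continuous_on) (simp add: linear_conv_bounded_linear)
  have unimodular: "?P f"
    if f: "linear f" "\<And>k. int_vec k \<Longrightarrow> int_vec (f k)"
    and g: "linear g" "\<And>k. int_vec k \<Longrightarrow> int_vec (g k)"
    and fg: "\<And>x. f (g x) = x" and gf: "\<And>x. g (f x) = x" for f g
  proof (intro impI ballI)
    fix h :: "real^'d \<Rightarrow> ennreal"
    assume nz: "det (matrix f) \<noteq> 0" and [measurable]: "h \<in> borel_measurable borel"
    have "matrix_inv (matrix f) *v k = g k" for k
      using matrix_inv_mult(2)[OF nz, of "g k"] f(1) by (simp add: matrix_works fg)
    then have "(\<integral>\<^sup>+x. h (matrix f *v x) \<partial>lborel) = (\<integral>\<^sup>+x. h x \<partial>lborel)"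
      by (intro nn_integral_unimodular nz integral_matrixI f) (simp_all add: g)
    then show "ennreal \<bar>det (matrix f)\<bar> * (\<integral>\<^sup>+x. h (f x) \<partial>lborel) = (\<integral>\<^sup>+x. h x \<partial>lborel)"
      using abs_det_unimodular[OF f g fg] f(1) by (simp add: matrix_works)
  qed
  show ?thesis
  proof (rule induct_linear_elementary[OF assms, of ?P])
    fix f g :: "real^'d \<Rightarrow> real^'d"
    assume lin: "linear f" "linear g" and f: "?P f" and g: "?P g"
    note [measurable] = meas[OF lin(1)] meas[OF lin(2)]
    have det: "det (matrix (f \<circ> g)) = det (matrix f) * det (matrix g)"
      by (simp add: matrix_compose lin det_mul)
    show "?P (f \<circ> g)"
    proof (intro impI ballI)
      fix h :: "real^'d \<Rightarrow> ennreal"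
      assume nz: "det (matrix (f \<circ> g)) \<noteq> 0" and [measurable]: "h \<in> borel_measurable borel"
      have "ennreal \<bar>det (matrix (f \<circ> g))\<bar> * (\<integral>\<^sup>+x. h ((f \<circ> g) x) \<partial>lborel) =
          ennreal \<bar>det (matrix f)\<bar> * (ennreal \<bar>det (matrix g)\<bar> * (\<integral>\<^sup>+x. h (f (g x)) \<partial>lborel))"
        by (simp add: det abs_mult ennreal_mult mult.assoc)
      also have "\<dots> = (\<integral>\<^sup>+x. h x \<partial>lborel)"
        using f[rule_format, of h] g[rule_format, of "\<lambda>x. h (f x)"] nz by (simp add: det)
      finally show "ennreal \<bar>det (matrix (f \<circ> g))\<bar> * (\<integral>\<^sup>+x. h ((f \<circ> g) x) \<partial>lborel) = (\<integral>\<^sup>+x. h x \<partial>lborel)" .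
    qed
  next
    \<comment> \<open>Singular maps have determinant zero, so the claim is vacuous for them.\<close>
    fix f :: "real^'d \<Rightarrow> real^'d" and i
    assume "linear f" "\<And>x. f x $ i = 0"
    then have "row i (matrix f) = 0"
      by (simp add: row_def matrix_def vec_eq_iff)
    then show "?P f" by (simp add: det_zero_row)
  next
    fix c :: "'d \<Rightarrow> real"
    let ?f = "\<lambda>x::real^'d. \<chi> i. c i * x $ i"
    have "matrix ?f = (\<chi> i j. if i = j then c i else 0)"
      by (simp add: matrix_def vec_eq_iff axis_def)
    then have det: "det (matrix ?f) = prod c UNIV"
      by (simp add: det_diagonal)
    show "?P ?f"
    proof (intro impI ballI)
      fix h :: "real^'d \<Rightarrow> ennreal"
      assume nz: "det (matrix ?f) \<noteq> 0" and [measurable]: "h \<in> borel_measurable borel"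
      \<comment> \<open>\<open>lborel_affine_euclidean\<close> expects scaling factors indexed by
        basis vectors; \<open>c'\<close> is \<open>c\<close> carried over from indices to
        \<open>Basis\<close>.\<close>
      define c' where "c' b = (\<Sum>i\<in>UNIV. c i * b $ i)" for b :: "real^'d"
      have c': "c' (axis i 1) = c i" for i
        by (simp add: c'_def axis_def if_distrib cong: if_cong)
      have Basis: "(Basis :: (real^'d) set) = (\<lambda>i. axis i 1) ` UNIV" and inj: "inj (\<lambda>i::'d. axis i (1::real))"
        by (auto simp: Basis_vec_def inj_on_def axis_eq_axis)
      have prod: "(\<Prod>b\<in>Basis. \<bar>c' b\<bar>) = \<bar>det (matrix ?f)\<bar>"
        unfolding Basis by (simp add: prod.reindex[OF inj] c' det abs_prod)
      have nz': "c' b \<noteq> 0" if "b \<in> Basis" for b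
        using that nz unfolding Basis by (auto simp: c' det)
      have T: "0 + (\<Sum>b\<in>Basis. (c' b * (x \<bullet> b)) *\<^sub>R b) = ?f x" for x
      proof -
        have "(\<Sum>b\<in>Basis. (c' b * (x \<bullet> b)) *\<^sub>R b) = (\<Sum>i\<in>UNIV. (c i * x $ i) *\<^sub>R axis i 1)"
          unfolding Basis sum.reindex[OF inj] by (simp add: c' inner_axis)
        also have "\<dots> = ?f x"
          by (simp add: vec_eq_iff axis_def if_distrib cong: if_cong)
        finally show ?thesis by simp
      qed
      have [measurable]: "?f \<in> borel_measurable borel"
        by (rule meas) (auto intro!: linearI simp: vec_eq_iff algebra_simps)
      have "(\<integral>\<^sup>+x. h x \<partial>lborel) = (\<integral>\<^sup>+x. h x \<partial>density (distr lborel borel ?f) (\<lambda>_. \<bar>det (matrix ?f)\<bar>))"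
        using lborel_affine_euclidean[of c' 0] nz' unfolding T prod by simp
      also have "\<dots> = ennreal \<bar>det (matrix ?f)\<bar> * (\<integral>\<^sup>+x. h (?f x) \<partial>lborel)"
        by (simp add: nn_integral_density nn_integral_distr nn_integral_cmult)
      finally show "ennreal \<bar>det (matrix ?f)\<bar> * (\<integral>\<^sup>+x. h (?f x) \<partial>lborel) = (\<integral>\<^sup>+x. h x \<partial>lborel)" ..
    qed
  next
    fix m n :: 'd assume "m \<noteq> n"
    let ?f = "\<lambda>x::real^'d. \<chi> i. x $ Transposition.transpose m n i"
    show "?P ?f"
      by (rule unimodular[of _ ?f]) (auto intro!: linearI simp: vec_eq_iff int_vec_def)
  next
    fix m n :: 'd assume "m \<noteq> n"
    let ?f = "\<lambda>x::real^'d. \<chi> i. if i = m then x $ m + x $ n else x $ i"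
    show "?P ?f"
      by (rule unimodular[of _ "\<lambda>x. \<chi> i. if i = m then x $ m - x $ n else x $ i"])
         (use \<open>m \<noteq> n\<close> in \<open>auto intro!: linearI simp: vec_eq_iff int_vec_def algebra_simps\<close>)
  qed
qed

section \<open>Cosets of the image lattice and the digit count\<close>

lemma digit_set_decompose:
  assumes "digit_set B D" "int_vec m"
  shows "\<exists>!g. g \<in> D \<and> (\<exists>k. int_vec k \<and> m = B *v k + g)"
  using assms(1)[unfolded digit_set_def, THEN conjunct2, rule_format, OF assms(2)]
  by (simp only: diff_eq_eq)

text \<open>Unfold the volume \<open>1 / \<bar>det B\<bar>\<close> of \<open>{x. B x + g \<in> unit_cell}\<close> over the cell for each digit \<open>g\<close>:
  the vectors \<open>B k + g\<close> run through \<open>\<int>\<^sup>d\<close> once, so these volumes add up to \<open>1\<close>.\<close>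
lemma digit_set_card:
  fixes B :: "real^'d^'d"
  assumes D: "digit_set B D" and B: "integral_matrix B" "det B \<noteq> 0"
  shows "finite D" and "real (card D) = \<bar>det B\<bar>"
proof -
  let ?Z = "{k :: real^'d. int_vec k}"
  have "D \<subseteq> ?Z" using D by (auto simp: digit_set_def)
  then have cD: "countable D" by (rule countable_subset) (rule countable_int_vec)
  have "det (matrix ((*v) B)) \<noteq> 0" using B by simp
  then have cov: "ennreal \<bar>det B\<bar> * (\<integral>\<^sup>+x. h (B *v x) \<partial>lborel) = (\<integral>\<^sup>+x. h x \<partial>lborel)"
    if "h \<in> borel_measurable borel" for h :: "real^'d \<Rightarrow> ennreal"
    using nn_integral_linear[of "(*v) B"] that by simp
  have slice: "ennreal \<bar>det B\<bar> * (\<integral>\<^sup>+x. (\<integral>\<^sup>+k. indicator unit_cell (B *v (x + k) + g) \<partial>count_space ?Z) \<partial>cell_measure) = 1" for g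
  proof -
    have "(\<integral>\<^sup>+x. indicator unit_cell (B *v x + g) \<partial>lborel) =
      (\<integral>\<^sup>+x. (\<integral>\<^sup>+k. indicator unit_cell (B *v (x + k) + g) \<partial>count_space ?Z) \<partial>cell_measure)"
      by (rule nn_integral_cell_unfold) simp
    moreover have "ennreal \<bar>det B\<bar> * (\<integral>\<^sup>+x. indicator unit_cell (B *v x + g) \<partial>lborel) = (\<integral>\<^sup>+x. indicator unit_cell (x + g) \<partial>lborel)"
      by (rule cov) simp
    moreover have "(\<integral>\<^sup>+x. indicator unit_cell (x + g) \<partial>lborel) = 1"
      using nn_integral_lborel_translate[of "indicator unit_cell" g] by (simp add: emeasure_unit_cell)
    ultimately show ?thesis by simp
  qed
  \<comment> \<open>A single integer vector m moves B x into the cell, and m = B k + g for exactly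
    one pair (g, k).\<close>
  have fiber: "(\<integral>\<^sup>+g. (\<integral>\<^sup>+k. indicator unit_cell (B *v (x + k) + g) \<partial>count_space ?Z) \<partial>count_space D) = 1" for x
  proof -
    obtain m where m: "int_vec m" "B *v x + m \<in> unit_cell"
      and m_uniq: "\<And>l. int_vec l \<Longrightarrow> B *v x + l \<in> unit_cell \<Longrightarrow> l = m"
      using ex1_cell_translate[of "B *v x"] by blast
    obtain g0 k0 where gk: "g0 \<in> D" "int_vec k0" "m = B *v k0 + g0"
      and g_uniq: "\<And>g k. g \<in> D \<Longrightarrow> int_vec k \<Longrightarrow> m = B *v k + g \<Longrightarrow> g = g0"
      using digit_set_decompose[OF D m(1)] by (elim ex1E) blast
    have iff: "B *v (x + k) + g \<in> unit_cell \<longleftrightarrow> g = g0 \<and> k = k0" if "g \<in> D" "int_vec k" for g k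
    proof
      assume "B *v (x + k) + g \<in> unit_cell"
      moreover have "int_vec (B *v k + g)"
        using that D B by (auto simp: digit_set_def int_vec_add int_vec_mult)
      ultimately have eq: "B *v k + g = m"
        by (intro m_uniq) (simp_all add: matrix_vector_right_distrib add.assoc)
      then have "g = g0" using g_uniq that by blast
      moreover from this have "B *v k = B *v k0" using eq gk by simp
      then have "k = k0" using matrix_inv_mult(2)[OF B(2)] by metis
      ultimately show "g = g0 \<and> k = k0" by simp
    next
      assume "g = g0 \<and> k = k0"
      then show "B *v (x + k) + g \<in> unit_cell"
        using m(2) gk(3) by (simp add: matrix_vector_right_distrib add.assoc)
    qed
    have inner: "(\<integral>\<^sup>+k. indicator unit_cell (B *v (x + k) + g) \<partial>count_space ?Z) = indicator {g0} g"
      if g: "g \<in> D" for g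
    proof -
      have "(\<integral>\<^sup>+k. indicator unit_cell (B *v (x + k) + g) \<partial>count_space ?Z) =
          (\<integral>\<^sup>+k. indicator {g0} g * indicator {k0} k \<partial>count_space ?Z)"
        by (rule nn_integral_cong) (use iff[OF g] in \<open>simp add: indicator_def\<close>)
      also have "\<dots> = indicator {g0} g" using gk(2) by (simp add: nn_integral_cmult)
      finally show ?thesis .
    qed
    have "(\<integral>\<^sup>+g. (\<integral>\<^sup>+k. indicator unit_cell (B *v (x + k) + g) \<partial>count_space ?Z) \<partial>count_space D) =
        (\<integral>\<^sup>+g. indicator {g0} g \<partial>count_space D)"
      by (rule nn_integral_cong) (simp add: inner)
    then show ?thesis using gk(1) by simp
  qed
  \<comment> \<open>D is not yet known to be finite. Counting in [0, \<infinity>] gives its size as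
    a real number, and finiteness follows.\<close>
  have "emeasure (count_space D) D = (\<integral>\<^sup>+g. 1 \<partial>count_space D)" by simp
  also have "\<dots> = (\<integral>\<^sup>+g. ennreal \<bar>det B\<bar> * (\<integral>\<^sup>+x. (\<integral>\<^sup>+k. indicator unit_cell (B *v (x + k) + g) \<partial>count_space ?Z) \<partial>cell_measure) \<partial>count_space D)"
    by (simp only: slice)
  also have "\<dots> = ennreal \<bar>det B\<bar> * (\<integral>\<^sup>+g. (\<integral>\<^sup>+x. (\<integral>\<^sup>+k. indicator unit_cell (B *v (x + k) + g) \<partial>count_space ?Z) \<partial>cell_measure) \<partial>count_space D)"
    by (simp add: nn_integral_cmult)
  also have "(\<integral>\<^sup>+g. (\<integral>\<^sup>+x. (\<integral>\<^sup>+k. indicator unit_cell (B *v (x + k) + g) \<partial>count_space ?Z) \<partial>cell_measure) \<partial>count_space D) =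
      (\<integral>\<^sup>+x. (\<integral>\<^sup>+g. (\<integral>\<^sup>+k. indicator unit_cell (B *v (x + k) + g) \<partial>count_space ?Z) \<partial>count_space D) \<partial>cell_measure)"
    by (rule nn_integral_count_space_nn_integral[OF cD, symmetric])
       (rule borel_measurable_countable_sum, auto simp: countable_int_vec)
  also have "\<dots> = 1" by (simp add: fiber cell.emeasure_space_1[simplified])
  finally have e: "emeasure (count_space D) D = ennreal \<bar>det B\<bar>" by simp
  then show fin: "finite D"
    by (metis emeasure_count_space_infinite ennreal_neq_top infinity_ennreal_def order_refl)
  then show "real (card D) = \<bar>det B\<bar>"
    using e by (simp add: emeasure_count_space_finite ennreal_of_nat_eq_real_of_nat)
qed

section \<open>Iterates and invariance of the transfer operator\<close>

lemma integral_matrix_mult: "integral_matrix A \<Longrightarrow> integral_matrix B \<Longrightarrow> integral_matrix (A ** B)"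
  by (auto simp: integral_matrix_def matrix_matrix_mult_def intro!: Ints_sum Ints_mult)

lemma matrix_inv_compose:
  fixes A B :: "real^'d^'d"
  assumes "det A \<noteq> 0" "det B \<noteq> 0"
  shows "matrix_inv (A ** B) *v x = matrix_inv B *v (matrix_inv A *v x)"
proof -
  have "det (A ** B) \<noteq> 0" using assms by (simp add: det_mul)
  moreover have "(A ** B) *v (matrix_inv B *v (matrix_inv A *v x)) = x"
    using assms by (simp add: matrix_inv_mult flip: matrix_vector_mul_assoc)
  ultimately show ?thesis using matrix_inv_mult(2) by metis
qed

lemma digit_set_int_vec: "digit_set B D \<Longrightarrow> g \<in> D \<Longrightarrow> int_vec g"
  by (simp add: digit_set_def)

lemma digit_set_unique:
  assumes "digit_set B D" "g \<in> D" "g' \<in> D" "int_vec k" "int_vec k'" "B *v k + g = B *v k' + g'"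
    and "integral_matrix B"
  shows "g = g'"
proof -
  have "int_vec (B *v k + g)"
    using assms digit_set_int_vec[OF assms(1)] by (simp add: int_vec_add int_vec_mult)
  from digit_set_decompose[OF assms(1) this] show ?thesis using assms by metis
qed

text \<open>Two-digit expansions: an integer vector is A m + g, and expanding m by B gives A B l +
  (g + A h). For uniqueness, g is read off modulo A; after cancelling A, h is read off modulo
  B.\<close>

lemma digit_set_compose:
  fixes A B :: "real^'d^'d"
  assumes A: "integral_matrix A" "det A \<noteq> 0" "digit_set A D"
    and B: "integral_matrix B" "det B \<noteq> 0" "digit_set B E"
  shows "inj_on (\<lambda>(g, h). g + A *v h) (D \<times> E)"
    and "digit_set (A ** B) ((\<lambda>(g, h). g + A *v h) ` (D \<times> E))"
proof -
  have uniq: "g = g' \<and> h = h'"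
    if "g \<in> D" "h \<in> E" "g' \<in> D" "h' \<in> E" "int_vec k" "int_vec k'"
      "A *v (B *v k) + (g + A *v h) = A *v (B *v k') + (g' + A *v h')" for g h g' h' k k'
  proof -
    have e: "A *v (B *v k + h) + g = A *v (B *v k' + h') + g'"
      using that(7) by (simp add: matrix_vector_right_distrib add_ac)
    have "int_vec (B *v k + h)" "int_vec (B *v k' + h')"
      using that B(1) digit_set_int_vec[OF B(3)] by (simp_all add: int_vec_add int_vec_mult)
    then have g: "g = g'" using digit_set_unique[OF A(3) that(1,3) _ _ e A(1)] by simp
    then have "A *v (B *v k + h) = A *v (B *v k' + h')" using e by simp
    then have "B *v k + h = B *v k' + h'" using matrix_inv_mult(2)[OF A(2)] by metis
    then have "h = h'" using digit_set_unique[OF B(3) that(2,4,5,6) _ B(1)] by simp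
    with g show ?thesis by simp
  qed
  show "inj_on (\<lambda>(g, h). g + A *v h) (D \<times> E)"
  proof (rule inj_onI, clarify)
    fix g h g' h' assume "g \<in> D" "h \<in> E" "g' \<in> D" "h' \<in> E" "g + A *v h = g' + A *v h'"
    then show "g = g' \<and> h = h'" using uniq[of g h g' h' 0 0] by simp
  qed
  show "digit_set (A ** B) ((\<lambda>(g, h). g + A *v h) ` (D \<times> E))"
    unfolding digit_set_def
  proof (intro conjI ballI allI impI)
    fix x assume "x \<in> (\<lambda>(g, h). g + A *v h) ` (D \<times> E)"
    then show "int_vec x"
      using A(1) digit_set_int_vec[OF A(3)] digit_set_int_vec[OF B(3)]
      by (auto simp: int_vec_add int_vec_mult)
  next
    fix k :: "real^'d" assume k: "int_vec k"
    obtain g m where g: "g \<in> D" "int_vec m" "k = A *v m + g"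
      using digit_set_decompose[OF A(3) k] by (elim ex1E) blast
    obtain h l where h: "h \<in> E" "int_vec l" "m = B *v l + h"
      using digit_set_decompose[OF B(3) g(2)] by (elim ex1E) blast
    have k_eq: "k = A *v (B *v l) + (g + A *v h)"
      by (simp add: g h matrix_vector_right_distrib add_ac)
    show "\<exists>!x. x \<in> (\<lambda>(g, h). g + A *v h) ` (D \<times> E) \<and> (\<exists>m. int_vec m \<and> k - x = (A ** B) *v m)"
    proof (rule ex1I[of _ "g + A *v h"])
      show "g + A *v h \<in> (\<lambda>(g, h). g + A *v h) ` (D \<times> E) \<and>
          (\<exists>m. int_vec m \<and> k - (g + A *v h) = (A ** B) *v m)"
        using g h k_eq by (auto simp flip: matrix_vector_mul_assoc)
    next
      fix x assume "x \<in> (\<lambda>(g, h). g + A *v h) ` (D \<times> E) \<and> (\<exists>m. int_vec m \<and> k - x = (A ** B) *v m)"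
      then obtain g' h' l' where x: "x = g' + A *v h'" "g' \<in> D" "h' \<in> E" "int_vec l'" "k - x = A *v (B *v l')"
        by (auto simp flip: matrix_vector_mul_assoc)
      then have "k = A *v (B *v l') + (g' + A *v h')" by (simp only: diff_eq_eq x(1))
      then show "x = g + A *v h"
        using uniq[OF x(2,3) g(1) h(1) x(4) h(2)] k_eq x(1) by simp
    qed
  qed
qed

text \<open>(A B)^-1 (x + g + A h) = B^-1 (A^-1 (x + g) + h), so averaging over the composite digits
  is the iterated average.\<close>

lemma transfer_compose:
  fixes A B :: "real^'d^'d"
  assumes A: "integral_matrix A" "det A \<noteq> 0" "digit_set A D"
    and B: "integral_matrix B" "det B \<noteq> 0" "digit_set B E"
  shows "transfer A D (transfer B E f) = transfer (A ** B) ((\<lambda>(g, h). g + A *v h) ` (D \<times> E)) f"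
proof
  fix x
  have "transfer (A ** B) ((\<lambda>(g, h). g + A *v h) ` (D \<times> E)) f x =
      1 / \<bar>det (A ** B)\<bar> * (\<Sum>(g, h)\<in>D \<times> E. f (matrix_inv (A ** B) *v (x + (g + A *v h))))"
    unfolding transfer_def by (subst sum.reindex[OF digit_set_compose(1)[OF A B]]) (simp add: case_prod_unfold)
  also have "\<dots> = 1 / \<bar>det (A ** B)\<bar> * (\<Sum>(g, h)\<in>D \<times> E. f (matrix_inv B *v (matrix_inv A *v (x + g) + h)))"
    using A B by (simp add: matrix_inv_compose matrix_vector_right_distrib matrix_inv_mult add.assoc)
  also have "\<dots> = transfer A D (transfer B E f) x"
    by (simp add: transfer_def det_mul abs_mult sum.cartesian_product sum_distrib_left case_prod_unfold field_simps)
  finally show "transfer A D (transfer B E f) x = transfer (A ** B) ((\<lambda>(g, h). g + A *v h) ` (D \<times> E)) f x" ..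
qed

lemma matrix_inv_1: "matrix_inv (mat 1 :: real^'d^'d) *v x = x"
  using matrix_inv_mult(1)[of "mat 1 :: real^'d^'d" x] by simp

text \<open>Iterates become a single transfer operator, so that all later estimates concern one
  integral matrix B with one digit set. For n = 0 the digit set {0} of the identity matrix gives the
  identity operator.\<close>

lemma transfer_power:
  fixes A :: "real^'d^'d"
  assumes A: "integral_matrix A" "det A \<noteq> 0" "digit_set A D"
  shows "\<exists>B E. integral_matrix B \<and> det B \<noteq> 0 \<and> digit_set B E \<and>
    (\<forall>x. B *v x = (((*v) A) ^^ n) x) \<and> transfer A D ^^ n = transfer B E"
proof (induction n)
  case 0
  have "integral_matrix (mat 1 :: real^'d^'d)" by (simp add: integral_matrix_def mat_def)
  moreover have "digit_set (mat 1 :: real^'d^'d) {0}" by (auto simp: digit_set_def)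
  moreover have "transfer (mat 1 :: real^'d^'d) {0} = id"
    by (rule ext)+ (simp add: transfer_def matrix_inv_1)
  ultimately show ?case by (intro exI[of _ "mat 1"] exI[of _ "{0}"]) simp
next
  case (Suc n)
  then obtain B E where B: "integral_matrix B" "det B \<noteq> 0" "digit_set B E"
    "\<forall>x. B *v x = (((*v) A) ^^ n) x" "transfer A D ^^ n = transfer B E" by blast
  have "transfer A D ^^ Suc n = transfer (A ** B) ((\<lambda>(g, h). g + A *v h) ` (D \<times> E))"
    by (rule ext) (simp add: B(5) transfer_compose[OF A B(1-3)])
  moreover have "integral_matrix (A ** B)" "det (A ** B) \<noteq> 0"
    using A B by (simp_all add: integral_matrix_mult det_mul)
  moreover note digit_set_compose(2)[OF A B(1-3)]
  moreover have "(A ** B) *v x = (((*v) A) ^^ Suc n) x" for x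
    using B(4) by (simp flip: matrix_vector_mul_assoc)
  ultimately show ?case by blast
qed

text \<open>Adding m permutes the cosets of B \<int>^d and so induces the permutation
  \<open>s\<close> of the digits. Replacing g + m by its digit changes the argument of h by an
  integer vector.\<close>

lemma digit_sum_shift:
  fixes h :: "real^'d \<Rightarrow> 'a::comm_monoid_add"
  assumes per: "zperiodic h" and B: "integral_matrix B" "det B \<noteq> 0" "digit_set B D" and m: "int_vec m"
  shows "(\<Sum>g\<in>D. h (matrix_inv B *v (x + g + m))) = (\<Sum>g\<in>D. h (matrix_inv B *v (x + g)))"
proof -
  have "\<exists>g' k. g' \<in> D \<and> int_vec k \<and> g + m = B *v k + g'" if "g \<in> D" for g
    using digit_set_decompose[OF B(3), of "g + m"] that m B(3)
    by (metis digit_set_int_vec int_vec_add)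
  then obtain s k where s: "\<And>g. g \<in> D \<Longrightarrow> s g \<in> D" "\<And>g. g \<in> D \<Longrightarrow> int_vec (k g)"
      "\<And>g. g \<in> D \<Longrightarrow> g + m = B *v k g + s g"
    by metis
  have fin: "finite D" by (rule digit_set_card(1)[OF B(3,1,2)])
  have inj: "inj_on s D"
  proof (rule inj_onI)
    fix g g' assume g: "g \<in> D" "g' \<in> D" "s g = s g'"
    have "B *v k g' + g + m = B *v k g + g' + m"
      unfolding add.assoc s(3)[OF g(1)] s(3)[OF g(2)] g(3) by (rule add.left_commute)
    then have "B *v k g + g' = B *v k g' + g" by simp
    then show "g = g'"
      using digit_set_unique[OF B(3) g(1,2) s(2)[OF g(2)] s(2)[OF g(1)] _ B(1)] by simp
  qed
  then have bij: "bij_betw s D D"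
    using s(1) fin by (simp add: bij_betw_def endo_inj_surj image_subset_iff)
  have "h (matrix_inv B *v (x + g + m)) = h (matrix_inv B *v (x + s g))" if g: "g \<in> D" for g
  proof -
    have e: "x + g + m = (x + s g) + B *v k g" using s(3)[OF g] by (simp add: add_ac)
    have "matrix_inv B *v (x + g + m) = matrix_inv B *v (x + s g) + k g"
      unfolding e matrix_vector_right_distrib[of _ "x + s g"] by (simp add: matrix_inv_mult B)
    then show ?thesis using per s(2)[OF g] by (simp add: zperiodicD)
  qed
  then have "(\<Sum>g\<in>D. h (matrix_inv B *v (x + g + m))) = (\<Sum>g\<in>D. h (matrix_inv B *v (x + s g)))"
    by simp
  also have "\<dots> = (\<Sum>g\<in>D. h (matrix_inv B *v (x + g)))"
    by (rule sum.reindex_bij_betw[OF bij])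
  finally show ?thesis .
qed

lemma transfer_periodic:
  assumes "zperiodic f" "integral_matrix B" "det B \<noteq> 0" "digit_set B D"
  shows "zperiodic (transfer B D f)"
  unfolding zperiodic_def transfer_def
proof (intro allI impI)
  fix x k :: "real^'a" assume "int_vec k"
  moreover have "x + k + g = x + g + k" for g by (simp add: add_ac)
  ultimately show "1 / \<bar>det B\<bar> * (\<Sum>g\<in>D. f (matrix_inv B *v (x + k + g))) =
      1 / \<bar>det B\<bar> * (\<Sum>g\<in>D. f (matrix_inv B *v (x + g)))"
    by (simp only: digit_sum_shift[OF assms])
qed

lemma borel_measurable_transfer [measurable]:
  assumes [measurable]: "f \<in> borel_measurable borel"
  shows "transfer B D f \<in> borel_measurable borel"
  unfolding transfer_def by measurable

text \<open>As an identity of image measures, invariance on nonnegative periodic functions carries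
  over to integrability and integrals of real ones. Reduction by \<open>vfrac\<close> turns
  indicators into periodic functions.\<close>

lemma distr_vfrac:
  assumes [measurable]: "T \<in> borel_measurable borel"
    and inv: "\<And>h :: real^'d \<Rightarrow> ennreal. h \<in> borel_measurable borel \<Longrightarrow> zperiodic h \<Longrightarrow>
      (\<integral>\<^sup>+x. h (T x) \<partial>cell_measure) = (\<integral>\<^sup>+x. h x \<partial>cell_measure)"
  shows "distr cell_measure borel (\<lambda>x. vfrac (T x)) = (cell_measure :: (real^'d) measure)"
proof (rule measure_eqI)
  fix S :: "(real^'d) set" assume "S \<in> sets (distr cell_measure borel (\<lambda>x. vfrac (T x)))"
  then have [measurable]: "S \<in> sets borel" by simp
  have "emeasure (distr cell_measure borel (\<lambda>x. vfrac (T x))) S = (\<integral>\<^sup>+x. indicator S (vfrac (T x)) \<partial>cell_measure)"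
    by (subst nn_integral_indicator[symmetric], simp, subst nn_integral_distr) simp_all
  also have "\<dots> = (\<integral>\<^sup>+x. indicator S (vfrac x) \<partial>cell_measure)"
    by (rule inv[of "\<lambda>x. indicator S (vfrac x)"]) (simp_all add: zperiodic_comp_vfrac)
  also have "\<dots> = (\<integral>\<^sup>+x. indicator S x \<partial>cell_measure)"
    using AE_cell_measure by (intro nn_integral_cong_AE) (auto simp: vfrac_cell elim!: eventually_mono)
  finally show "emeasure (distr cell_measure borel (\<lambda>x. vfrac (T x))) S = emeasure cell_measure S" by simp
qed simp

lemma integral_cell_invariant:
  fixes f :: "real^'d \<Rightarrow> real"
  assumes [measurable]: "T \<in> borel_measurable borel" "f \<in> borel_measurable borel" and per: "zperiodic f"
    and inv: "\<And>h :: real^'d \<Rightarrow> ennreal. h \<in> borel_measurable borel \<Longrightarrow> zperiodic h \<Longrightarrow>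
      (\<integral>\<^sup>+x. h (T x) \<partial>cell_measure) = (\<integral>\<^sup>+x. h x \<partial>cell_measure)"
  shows "integrable cell_measure (\<lambda>x. f (T x)) \<longleftrightarrow> integrable cell_measure f"
    and "(\<integral>x. f (T x) \<partial>cell_measure) = (\<integral>x. f x \<partial>cell_measure)"
proof -
  have d: "distr cell_measure borel (\<lambda>x. vfrac (T x)) = (cell_measure :: (real^'d) measure)"
    by (rule distr_vfrac) (use inv in auto)
  have "integrable (distr cell_measure borel (\<lambda>x. vfrac (T x))) f \<longleftrightarrow> integrable cell_measure (\<lambda>x. f (vfrac (T x)))"
    by (rule integrable_distr_eq) simp_all
  then show "integrable cell_measure (\<lambda>x. f (T x)) \<longleftrightarrow> integrable cell_measure f"
    by (simp add: d zperiodic_vfrac[OF per])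
  have "(\<integral>x. f x \<partial>distr cell_measure borel (\<lambda>x. vfrac (T x))) = (\<integral>x. f (vfrac (T x)) \<partial>cell_measure)"
    by (rule integral_distr) simp_all
  then show "(\<integral>x. f (T x) \<partial>cell_measure) = (\<integral>x. f x \<partial>cell_measure)"
    by (simp add: d zperiodic_vfrac[OF per])
qed

lemma integral_cell_translate:
  fixes f :: "real^'d \<Rightarrow> real"
  assumes [measurable]: "f \<in> borel_measurable borel" and per: "zperiodic f"
  shows "integrable cell_measure (\<lambda>x. f (x + v)) \<longleftrightarrow> integrable cell_measure f"
    and "(\<integral>x. f (x + v) \<partial>cell_measure) = (\<integral>x. f x \<partial>cell_measure)"
  by (rule integral_cell_invariant[where T = "\<lambda>x. x + v"]; use per in \<open>simp add: nn_integral_cell_translate\<close>)+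

text \<open>Composition with B removes the inverse branches: at B x the transfer is the average of
  the translates f (x + B^-1 g). Both B and translations preserve the measure, and the number of
  digits cancels |det B|.\<close>

lemma integral_transfer:
  fixes f :: "real^'d \<Rightarrow> real"
  assumes [measurable]: "f \<in> borel_measurable borel" and per: "zperiodic f" and int: "integrable cell_measure f"
    and B: "integral_matrix B" "det B \<noteq> 0" "digit_set B D"
  shows "integrable cell_measure (transfer B D f)"
    and "(\<integral>x. transfer B D f x \<partial>cell_measure) = (\<integral>x. f x \<partial>cell_measure)"
proof -
  have perL: "zperiodic (transfer B D f)" by (rule transfer_periodic[OF per B])
  have eq: "transfer B D f (B *v x) = 1 / \<bar>det B\<bar> * (\<Sum>g\<in>D. f (x + matrix_inv B *v g))" for x
    by (simp add: transfer_def matrix_vector_right_distrib matrix_inv_mult B)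
  have shift: "integrable cell_measure (\<lambda>x. f (x + v))" "(\<integral>x. f (x + v) \<partial>cell_measure) = (\<integral>x. f x \<partial>cell_measure)" for v
    using integral_cell_translate[OF _ per, of v] int by auto
  have inv: "(\<integral>\<^sup>+x. h (B *v x) \<partial>cell_measure) = (\<integral>\<^sup>+x. h x \<partial>cell_measure)"
    if "h \<in> borel_measurable borel" "zperiodic h" for h :: "real^'d \<Rightarrow> ennreal"
    by (rule nn_integral_cell_endomorphism) (use that B in auto)
  have endo: "integrable cell_measure (\<lambda>x. transfer B D f (B *v x)) \<longleftrightarrow> integrable cell_measure (transfer B D f)"
    "(\<integral>x. transfer B D f (B *v x) \<partial>cell_measure) = (\<integral>x. transfer B D f x \<partial>cell_measure)"
    by (rule integral_cell_invariant[where T = "(*v) B"]; use perL inv in simp)+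
  have "integrable cell_measure (\<lambda>x. transfer B D f (B *v x))"
    unfolding eq using shift by simp
  then show "integrable cell_measure (transfer B D f)" using endo(1) by simp
  have "(\<integral>x. transfer B D f x \<partial>cell_measure) = (\<integral>x. transfer B D f (B *v x) \<partial>cell_measure)"
    using endo(2) by simp
  also have "\<dots> = (\<integral>x. f x \<partial>cell_measure)"
    unfolding eq using shift B digit_set_card(2)[OF B(3,1,2)] by simp
  finally show "(\<integral>x. transfer B D f x \<partial>cell_measure) = (\<integral>x. f x \<partial>cell_measure)" .
qed

section \<open>Estimates for mean-zero functions\<close>

lemma convex_on_abs_powr:
  assumes p: "p \<ge> 1"
  shows "convex_on UNIV (\<lambda>x::real. \<bar>x\<bar> powr p)"
proof (rule convex_onI)
  fix t x y :: real assume t: "0 < t" "t < 1"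
  \<comment> \<open>Handles the endpoint 0 of the half-line, where the convexity inequality reduces
    to s^p \<le> s for 0 < s < 1.\<close>
  have small: "(s * b) powr p \<le> s * b powr p" if "0 < s" "s < 1" "b \<ge> 0" for s b :: real
  proof -
    have "s powr p \<le> s powr 1" using that p by (intro powr_mono') auto
    then show ?thesis using that by (simp add: powr_mult mult_right_mono)
  qed
  have conv: "((1 - t) * a + t * b) powr p \<le> (1 - t) * a powr p + t * b powr p"
    if "a \<ge> 0" "b \<ge> 0" for a b :: real
  proof (cases "a = 0 \<or> b = 0")
    case True
    then show ?thesis using small[of t b] small[of "1 - t" a] t that p by auto
  next
    case False
    then show ?thesis
      using convex_onD[OF powr_convex[OF p], of t a b] t that by simp
  qed
  have "\<bar>(1 - t) *\<^sub>R x + t *\<^sub>R y\<bar> \<le> (1 - t) * \<bar>x\<bar> + t * \<bar>y\<bar>"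
    using abs_triangle_ineq[of "(1 - t) * x" "t * y"] t by (simp add: abs_mult)
  then have "\<bar>(1 - t) *\<^sub>R x + t *\<^sub>R y\<bar> powr p \<le> ((1 - t) * \<bar>x\<bar> + t * \<bar>y\<bar>) powr p"
    using p by (intro powr_mono2) auto
  also have "\<dots> \<le> (1 - t) * \<bar>x\<bar> powr p + t * \<bar>y\<bar> powr p"
    by (rule conv) auto
  finally show "\<bar>(1 - t) *\<^sub>R x + t *\<^sub>R y\<bar> powr p \<le> (1 - t) * \<bar>x\<bar> powr p + t * \<bar>y\<bar> powr p" .
qed simp

lemma abs_average_powr_le:
  fixes a :: "'i \<Rightarrow> real"
  assumes "p \<ge> 1" "finite I" "I \<noteq> {}"
  shows "\<bar>1 / card I * (\<Sum>i\<in>I. a i)\<bar> powr p \<le> 1 / card I * (\<Sum>i\<in>I. \<bar>a i\<bar> powr p)"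
proof -
  have "\<bar>\<Sum>i\<in>I. (1 / card I) *\<^sub>R a i\<bar> powr p \<le> (\<Sum>i\<in>I. 1 / card I * \<bar>a i\<bar> powr p)"
    using assms by (intro convex_on_sum[OF _ _ convex_on_abs_powr]) auto
  then show ?thesis by (simp add: sum_distrib_left)
qed

text \<open>Serves only the integrability of differences, so a crude constant is enough.\<close>

lemma abs_diff_powr_le:
  fixes a b :: real
  assumes "p \<ge> 1"
  shows "\<bar>a - b\<bar> powr p \<le> 2 powr p * (\<bar>a\<bar> powr p + \<bar>b\<bar> powr p)"
proof -
  have "\<bar>a - b\<bar> powr p \<le> (2 * max \<bar>a\<bar> \<bar>b\<bar>) powr p"
    using assms by (intro powr_mono2) auto
  also have "\<dots> \<le> 2 powr p * (\<bar>a\<bar> powr p + \<bar>b\<bar> powr p)"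
    by (auto simp: powr_mult max_def)
  finally show ?thesis .
qed

text \<open>Norms enter as integrals of p-th powers, with the root taken once at the end; convexity
  then does the work of the triangle inequality.\<close>

definition cell_Lp :: "real \<Rightarrow> (real^'d \<Rightarrow> real) \<Rightarrow> bool" where
  "cell_Lp p f \<longleftrightarrow> f \<in> borel_measurable borel \<and> zperiodic f \<and> integrable cell_measure (\<lambda>x. \<bar>f x\<bar> powr p)"

lemma cell_Lp_measurable [measurable_dest]: "cell_Lp p f \<Longrightarrow> f \<in> borel_measurable borel"
  and cell_Lp_periodic: "cell_Lp p f \<Longrightarrow> zperiodic f"
  and cell_Lp_integrable_powr: "cell_Lp p f \<Longrightarrow> integrable cell_measure (\<lambda>x. \<bar>f x\<bar> powr p)"
  by (simp_all add: cell_Lp_def)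

lemma zperiodic_comp: "zperiodic f \<Longrightarrow> zperiodic (\<lambda>x. h (f x))"
  and zperiodic_comp2: "zperiodic f \<Longrightarrow> zperiodic g \<Longrightarrow> zperiodic (\<lambda>x. h' (f x) (g x))"
  by (simp_all add: zperiodic_def)

lemma zperiodic_translate: "zperiodic f \<Longrightarrow> zperiodic (\<lambda>x. f (x + v))"
  unfolding zperiodic_def by (metis add.assoc add.commute)

lemma cell_Lp_integrable:
  assumes "p \<ge> 1" and f: "cell_Lp p f"
  shows "integrable cell_measure f"
proof (rule Bochner_Integration.integrable_bound)
  show "integrable cell_measure (\<lambda>x. 1 + \<bar>f x\<bar> powr p)"
    using cell_Lp_integrable_powr[OF f] by simp
  have "\<bar>y\<bar> \<le> 1 + \<bar>y\<bar> powr p" for y :: real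
  proof (cases "\<bar>y\<bar> \<le> 1")
    case False
    then have "\<bar>y\<bar> powr 1 \<le> \<bar>y\<bar> powr p" using assms by (intro powr_mono) auto
    then show ?thesis by simp
  qed (simp add: add_increasing2)
  then show "AE x in cell_measure. norm (f x) \<le> norm (1 + \<bar>f x\<bar> powr p)"
    by (simp add: add_nonneg_nonneg)
qed (use f in measurable)

lemma cell_Lp_translate:
  assumes f: "cell_Lp p f"
  shows "cell_Lp p (\<lambda>x. f (x + v))"
    and "(\<integral>x. \<bar>f (x + v)\<bar> powr p \<partial>cell_measure) = (\<integral>x. \<bar>f x\<bar> powr p \<partial>cell_measure)"
proof -
  note [measurable] = cell_Lp_measurable[OF f]
  have per: "zperiodic (\<lambda>x. \<bar>f x\<bar> powr p)"
    using cell_Lp_periodic[OF f] by (rule zperiodic_comp)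
  note tr = integral_cell_translate[OF _ per, of v]
  show "cell_Lp p (\<lambda>x. f (x + v))"
    using tr(1) f zperiodic_translate[OF cell_Lp_periodic[OF f]] by (simp add: cell_Lp_def)
  show "(\<integral>x. \<bar>f (x + v)\<bar> powr p \<partial>cell_measure) = (\<integral>x. \<bar>f x\<bar> powr p \<partial>cell_measure)"
    using tr(2) by simp
qed

lemma cell_Lp_diff:
  assumes p: "p \<ge> 1" and f: "cell_Lp p f" and g: "cell_Lp p g"
  shows "cell_Lp p (\<lambda>x. f x - g x)"
proof -
  note [measurable] = cell_Lp_measurable[OF f] cell_Lp_measurable[OF g]
  have "integrable cell_measure (\<lambda>x. \<bar>f x - g x\<bar> powr p)"
  proof (rule Bochner_Integration.integrable_bound)
    show "integrable cell_measure (\<lambda>x. 2 powr p * (\<bar>f x\<bar> powr p + \<bar>g x\<bar> powr p))"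
      using f g by (simp add: cell_Lp_integrable_powr)
    show "AE x in cell_measure. norm (\<bar>f x - g x\<bar> powr p) \<le> norm (2 powr p * (\<bar>f x\<bar> powr p + \<bar>g x\<bar> powr p))"
      using abs_diff_powr_le[OF p] by simp
  qed simp
  then show ?thesis
    using zperiodic_comp2[OF cell_Lp_periodic[OF f] cell_Lp_periodic[OF g]] by (simp add: cell_Lp_def)
qed

text \<open>Jensen's inequality over the digits bounds the p-th power of the transfer by the
  transfer of |f|^p, whose integral is that of |f|^p. The weights sum to 1 because the number of
  digits is |det B|.\<close>

lemma cell_Lp_transfer:
  assumes p: "p \<ge> 1" and f: "cell_Lp p f" and B: "integral_matrix B" "det B \<noteq> 0" "digit_set B D"
  shows "cell_Lp p (transfer B D f)"
    and "(\<integral>x. \<bar>transfer B D f x\<bar> powr p \<partial>cell_measure) \<le> (\<integral>x. \<bar>f x\<bar> powr p \<partial>cell_measure)"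
proof -
  note [measurable] = cell_Lp_measurable[OF f]
  have per: "zperiodic (\<lambda>x. \<bar>f x\<bar> powr p)"
    using cell_Lp_periodic[OF f] by (rule zperiodic_comp)
  note tr = integral_transfer[OF _ per cell_Lp_integrable_powr[OF f] B]
  note card = digit_set_card[OF B(3,1,2)]
  have "D \<noteq> {}" using card B by auto
  then have le: "\<bar>transfer B D f x\<bar> powr p \<le> transfer B D (\<lambda>x. \<bar>f x\<bar> powr p) x" for x
    using abs_average_powr_le[OF p card(1), of "\<lambda>g. f (matrix_inv B *v (x + g))"]
    by (simp add: transfer_def card(2))
  have nonneg: "0 \<le> transfer B D (\<lambda>x. \<bar>f x\<bar> powr p) x" for x
    by (rule order_trans[OF _ le]) simp
  have int: "integrable cell_measure (\<lambda>x. \<bar>transfer B D f x\<bar> powr p)"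
    by (rule Bochner_Integration.integrable_bound[OF tr(1)]) (use le nonneg in auto)
  then show "cell_Lp p (transfer B D f)"
    using transfer_periodic[OF cell_Lp_periodic[OF f] B] by (simp add: cell_Lp_def)
  have "(\<integral>x. \<bar>transfer B D f x\<bar> powr p \<partial>cell_measure) \<le> (\<integral>x. transfer B D (\<lambda>x. \<bar>f x\<bar> powr p) x \<partial>cell_measure)"
    by (rule integral_mono[OF int tr(1) le]) simp
  then show "(\<integral>x. \<bar>transfer B D f x\<bar> powr p \<partial>cell_measure) \<le> (\<integral>x. \<bar>f x\<bar> powr p \<partial>cell_measure)"
    using tr(2) by simp
qed

text \<open>A mean-zero function is the average of its own translation differences, so Jensen's
  inequality bounds its norm by theirs.\<close>
lemma mean_zero_bound:
  fixes F :: "real^'d \<Rightarrow> real"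
  assumes p: "p \<ge> 1" and F: "cell_Lp p F" and mean: "(\<integral>x. F x \<partial>cell_measure) = 0"
    and bound: "\<And>t. (\<integral>x. \<bar>F x - F (x + t)\<bar> powr p \<partial>cell_measure) \<le> K"
  shows "(\<integral>x. \<bar>F x\<bar> powr p \<partial>cell_measure) \<le> K"
proof -
  interpret P: pair_sigma_finite "cell_measure :: (real^'d) measure" "cell_measure :: (real^'d) measure" ..
  note [measurable] = cell_Lp_measurable[OF F]
  have int: "integrable cell_measure (\<lambda>t. F (x + t))" and mean_x: "(\<integral>t. F (x + t) \<partial>cell_measure) = 0" for x
    using integral_cell_translate[OF _ cell_Lp_periodic[OF F], of x] cell_Lp_integrable[OF p F] mean
    by (simp_all add: add.commute)
  have const: "cell_Lp p (\<lambda>_. c)" for c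
    by (simp add: cell_Lp_def zperiodic_def)
  have int_t: "integrable cell_measure (\<lambda>t. \<bar>F x - F (x + t)\<bar> powr p)" for x
    using cell_Lp_integrable_powr[OF cell_Lp_diff[OF p const[of "F x"] cell_Lp_translate(1)[OF F, of x]]]
    by (simp add: add.commute)
  have int_x: "integrable cell_measure (\<lambda>x. \<bar>F x - F (x + t)\<bar> powr p)" for t
    by (rule cell_Lp_integrable_powr[OF cell_Lp_diff[OF p F cell_Lp_translate(1)[OF F]]])
  have jensen: "\<bar>F x\<bar> powr p \<le> (\<integral>t. \<bar>F x - F (x + t)\<bar> powr p \<partial>cell_measure)" for x
  proof -
    have "\<bar>\<integral>t. F x - F (x + t) \<partial>cell_measure\<bar> powr p \<le> (\<integral>t. \<bar>F x - F (x + t)\<bar> powr p \<partial>cell_measure)"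
      by (rule cell.jensens_inequality[where I = UNIV and q = "\<lambda>y. \<bar>y\<bar> powr p"])
         (use int int_t convex_on_abs_powr[OF p] in auto)
    then show ?thesis using int mean_x by (simp add: cell.prob_space[simplified])
  qed
  \<comment> \<open>The double integral is handled in [0, \<infinity>], where exchanging the order
    asks only for joint measurability.\<close>
  have "ennreal (\<integral>x. \<bar>F x\<bar> powr p \<partial>cell_measure) = (\<integral>\<^sup>+x. \<bar>F x\<bar> powr p \<partial>cell_measure)"
    by (rule nn_integral_eq_integral[symmetric]) (simp_all add: cell_Lp_integrable_powr[OF F])
  also have "\<dots> \<le> (\<integral>\<^sup>+x. (\<integral>\<^sup>+t. \<bar>F x - F (x + t)\<bar> powr p \<partial>cell_measure) \<partial>cell_measure)"
  proof (rule nn_integral_mono)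
    fix x
    show "ennreal (\<bar>F x\<bar> powr p) \<le> (\<integral>\<^sup>+t. \<bar>F x - F (x + t)\<bar> powr p \<partial>cell_measure)"
      by (subst nn_integral_eq_integral) (use int_t jensen in \<open>auto simp: ennreal_leI\<close>)
  qed
  also have "\<dots> = (\<integral>\<^sup>+t. (\<integral>\<^sup>+x. \<bar>F x - F (x + t)\<bar> powr p \<partial>cell_measure) \<partial>cell_measure)"
    by (rule P.Fubini'[symmetric]) simp
  also have "\<dots> \<le> (\<integral>\<^sup>+t. ennreal K \<partial>(cell_measure :: (real^'d) measure))"
  proof (rule nn_integral_mono)
    fix t
    show "(\<integral>\<^sup>+x. \<bar>F x - F (x + t)\<bar> powr p \<partial>cell_measure) \<le> ennreal K"
      by (subst nn_integral_eq_integral) (use int_x bound in \<open>auto simp: ennreal_leI\<close>)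
  qed
  also have "\<dots> = ennreal K" by (simp add: cell.emeasure_space_1[simplified])
  finally have "ennreal (\<integral>x. \<bar>F x\<bar> powr p \<partial>cell_measure) \<le> ennreal K" .
  moreover have "K \<ge> 0" using bound[of 0] by (rule order_trans[rotated]) simp
  ultimately show ?thesis by (simp add: ennreal_le_iff)
qed

text \<open>Periodicity of the transfer absorbs m, and B w passes through each inverse branch as the
  translation by w.\<close>

lemma transfer_translate_diff:
  fixes f :: "real^'d \<Rightarrow> real"
  assumes per: "zperiodic f" and B: "integral_matrix B" "det B \<noteq> 0" "digit_set B D"
    and t: "int_vec m" "t - m = B *v w"
  shows "transfer B D f x - transfer B D f (x + t) = transfer B D (\<lambda>y. f y - f (y + w)) x"
proof -
  have e: "x + t = x + B *v w + m" using t(2) by (simp add: diff_eq_eq add.assoc)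
  have "transfer B D f (x + t) = transfer B D f (x + B *v w)"
    unfolding e by (rule zperiodicD[OF transfer_periodic[OF per B] t(1)])
  also have "\<dots> = transfer B D (\<lambda>y. f (y + w)) x"
    using B by (simp add: transfer_def matrix_vector_right_distrib matrix_inv_mult add_ac)
  finally show ?thesis
    by (simp add: transfer_def sum_subtractf right_diff_distrib diff_divide_distrib)
qed

lemma transfer_Lp_bound:
  fixes f :: "real^'d \<Rightarrow> real"
  assumes p: "p \<ge> 1" and f: "cell_Lp p f" and mean: "(\<integral>x. f x \<partial>cell_measure) = 0"
    and B: "integral_matrix B" "det B \<noteq> 0" "digit_set B D"
    and cover: "\<And>t. \<exists>m w. int_vec m \<and> t - m = B *v w \<and> norm w \<le> R"
    and bound: "\<And>w. norm w \<le> R \<Longrightarrow> (\<integral>x. \<bar>f (x + w) - f x\<bar> powr p \<partial>cell_measure) \<le> K"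
  shows "(\<integral>x. \<bar>transfer B D f x\<bar> powr p \<partial>cell_measure) \<le> K"
proof (rule mean_zero_bound[OF p cell_Lp_transfer(1)[OF p f B]])
  show "(\<integral>x. transfer B D f x \<partial>cell_measure) = 0"
    using integral_transfer(2)[OF cell_Lp_measurable[OF f] cell_Lp_periodic[OF f] cell_Lp_integrable[OF p f] B] mean
    by simp
next
  fix t
  obtain m w where w: "int_vec m" "t - m = B *v w" "norm w \<le> R" using cover by blast
  have diff: "cell_Lp p (\<lambda>y. f y - f (y + w))"
    by (rule cell_Lp_diff[OF p f cell_Lp_translate(1)[OF f]])
  have "(\<integral>x. \<bar>transfer B D f x - transfer B D f (x + t)\<bar> powr p \<partial>cell_measure) =
      (\<integral>x. \<bar>transfer B D (\<lambda>y. f y - f (y + w)) x\<bar> powr p \<partial>cell_measure)"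
    by (simp add: transfer_translate_diff[OF cell_Lp_periodic[OF f] B w(1,2)])
  also have "\<dots> \<le> (\<integral>x. \<bar>f x - f (x + w)\<bar> powr p \<partial>cell_measure)"
    by (rule cell_Lp_transfer(2)[OF p diff B])
  also have "\<dots> \<le> K" using bound[OF w(3)] by (simp add: abs_minus_commute)
  finally show "(\<integral>x. \<bar>transfer B D f x - transfer B D f (x + t)\<bar> powr p \<partial>cell_measure) \<le> K" .
qed

text \<open>The translation by v is made of N translations by v / N. Writing the telescoping sum as
  N times an average lets Jensen's inequality give the factor N^p.\<close>

lemma Lp_modulus_multiple:
  fixes f :: "real^'d \<Rightarrow> real"
  assumes p: "p \<ge> 1" and f: "cell_Lp p f" and N: "N \<ge> (1::nat)"
    and bound: "\<And>v. norm v \<le> \<delta> \<Longrightarrow> (\<integral>x. \<bar>f (x + v) - f x\<bar> powr p \<partial>cell_measure) \<le> K"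
    and v: "norm v \<le> N * \<delta>"
  shows "(\<integral>x. \<bar>f (x + v) - f x\<bar> powr p \<partial>cell_measure) \<le> N powr p * K"
proof -
  define w where "w = (1 / N) *\<^sub>R v"
  have w: "norm w \<le> \<delta>" using v N by (simp add: w_def divide_le_eq mult.commute)
  define a where "a i x = f (x + real i *\<^sub>R w + w) - f (x + real i *\<^sub>R w)" for i :: nat and x
  have diff: "cell_Lp p (\<lambda>x. f (x + w) - f x)"
    by (rule cell_Lp_diff[OF p cell_Lp_translate(1)[OF f] f])
  have a: "cell_Lp p (a i)" "(\<integral>x. \<bar>a i x\<bar> powr p \<partial>cell_measure) \<le> K" for i
    using cell_Lp_translate[OF diff, of "real i *\<^sub>R w"] bound[OF w] by (simp_all add: a_def[abs_def])
  have tele: "(\<Sum>i<n. a i x) = f (x + real n *\<^sub>R w) - f x" for n x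
    by (induction n) (simp_all add: a_def algebra_simps)
  have le: "\<bar>f (x + v) - f x\<bar> powr p \<le> N powr p * (1 / N * (\<Sum>i<N. \<bar>a i x\<bar> powr p))" for x
  proof -
    have "f (x + v) - f x = N * (1 / card {..<N} * (\<Sum>i<N. a i x))"
      using tele[where n = N and x = x] N by (simp add: w_def)
    then have "\<bar>f (x + v) - f x\<bar> powr p = N powr p * \<bar>1 / card {..<N} * (\<Sum>i<N. a i x)\<bar> powr p"
      by (simp only: abs_mult powr_mult abs_of_nat)
    also have "\<dots> \<le> N powr p * (1 / card {..<N} * (\<Sum>i<N. \<bar>a i x\<bar> powr p))"
      using N by (intro mult_left_mono abs_average_powr_le[OF p]) (auto simp: lessThan_empty_iff)
    finally show ?thesis by simp
  qed
  have "(\<integral>x. \<bar>f (x + v) - f x\<bar> powr p \<partial>cell_measure) \<le>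
      (\<integral>x. N powr p * (1 / N * (\<Sum>i<N. \<bar>a i x\<bar> powr p)) \<partial>cell_measure)"
    by (rule integral_mono[OF _ _ le])
       (use cell_Lp_integrable_powr[OF cell_Lp_diff[OF p cell_Lp_translate(1)[OF f, of v] f]]
          cell_Lp_integrable_powr[OF a(1)] in auto)
  also have "\<dots> = N powr p * (1 / N * (\<Sum>i<N. (\<integral>x. \<bar>a i x\<bar> powr p \<partial>cell_measure)))"
    using cell_Lp_integrable_powr[OF a(1)] by simp
  also have "\<dots> \<le> N powr p * (1 / N * (\<Sum>i<N. K))"
    by (intro mult_left_mono sum_mono a) auto
  also have "\<dots> = N powr p * K" using N by simp
  finally show ?thesis .
qed

section \<open>From the torus measure to the unit cell\<close>

lemma AE_lborel_translate:
  assumes "AE x in lborel. P (x :: 'a::euclidean_space)"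
  shows "AE x in lborel. P (x + v)"
proof -
  have "AE x in distr lborel borel ((+) v). P x"
    unfolding lborel_distr_plus by (rule assms)
  then have "AE x in lborel. P (v + x)" by (rule AE_distrD[rotated]) simp
  then show ?thesis by (simp add: add.commute)
qed

lemma AE_lborel_linear:
  fixes B :: "real^'d^'d"
  assumes "AE x in lborel. P x" and B: "det B \<noteq> 0"
  shows "AE x in lborel. P (B *v x)"
proof -
  obtain N where N: "{x. \<not> P x} \<subseteq> N" "N \<in> null_sets lborel"
    using assms(1) by (auto simp: eventually_ae_filter)
  then have [measurable]: "N \<in> sets borel" by (simp add: null_sets_def)
  have "ennreal \<bar>det B\<bar> * (\<integral>\<^sup>+x. indicator N (B *v x) \<partial>lborel) = (\<integral>\<^sup>+x. indicator N x \<partial>lborel)"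
    using nn_integral_linear[of "(*v) B"] B by simp
  also have "\<dots> = 0" using N by (simp add: null_setsD1)
  finally have "(\<integral>\<^sup>+x. indicator N (B *v x) \<partial>lborel) = 0"
    using B by simp
  then have "AE x in lborel. indicator N (B *v x) = (0::ennreal)"
    by (subst (asm) nn_integral_0_iff_AE) simp_all
  then show ?thesis by (rule eventually_mono) (use N(1) in \<open>auto simp: indicator_def split: if_splits\<close>)
qed

text \<open>Exceptional null sets stay null under translations and invertible linear maps, so the
  operator acts on almost-everywhere classes.\<close>

lemma AE_lborel_transfer:
  fixes f g :: "real^'d \<Rightarrow> real"
  assumes ae: "AE x in lborel. f x = g x" and B: "det B \<noteq> 0" and D: "finite D"
  shows "AE x in lborel. transfer B D f x = transfer B D g x"
proof -
  have "det (matrix_inv B) \<noteq> 0"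
  proof -
    have "B ** matrix_inv B = mat 1"
      using B by (simp add: matrix_eq matrix_inv_mult flip: matrix_vector_mul_assoc)
    then have "det B * det (matrix_inv B) = 1" by (metis det_I det_mul)
    then show ?thesis by auto
  qed
  then have "AE x in lborel. f (matrix_inv B *v (x + v)) = g (matrix_inv B *v (x + v))" for v
    by (intro AE_lborel_translate[where P = "\<lambda>x. f (matrix_inv B *v x) = g (matrix_inv B *v x)"]
        AE_lborel_linear[where P = "\<lambda>x. f x = g x"] ae)
  then have "AE x in lborel. \<forall>v\<in>D. f (matrix_inv B *v (x + v)) = g (matrix_inv B *v (x + v))"
    using D by (intro AE_finite_allI)
  then show ?thesis by (rule eventually_mono) (simp add: transfer_def)
qed

lemma AE_lborel_cell: "AE x in lborel. P x \<Longrightarrow> AE x in cell_measure. P x"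
  unfolding cell_measure_def by (subst AE_density) (auto elim: eventually_mono)

lemma unit_cell_subset_cbox: "(unit_cell :: (real^'d) set) \<subseteq> cbox 0 One"
  by (auto simp: unit_cell_def mem_box_cart sum_Basis_nth less_imp_le)

lemma AE_cbox_iff_unit_cell: "AE x in lborel. x \<in> cbox 0 One \<longleftrightarrow> x \<in> (unit_cell :: (real^'d) set)"
proof -
  have "negligible (cbox 0 One - box 0 One :: (real^'d) set)"
    by (rule negligible_frontier_interval)
  then have "AE x in lebesgue. x \<notin> (cbox 0 One - box 0 One :: (real^'d) set)"
    unfolding negligible_iff_null_sets by (rule AE_not_in)
  then have "AE x in lborel. x \<notin> (cbox 0 One - box 0 One :: (real^'d) set)"
    by (simp add: AE_completion_iff)
  moreover have "(box 0 One :: (real^'d) set) \<subseteq> unit_cell"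
    by (auto simp: unit_cell_def mem_box_cart sum_Basis_nth less_imp_le)
  ultimately show ?thesis
    using unit_cell_subset_cbox by (auto elim!: eventually_mono)
qed

text \<open>The boundary of the cube is null and completion does not change integrals. Equality
  almost everywhere in the whole space is the form that is stable under translation and
  transfer.\<close>

lemma torus_integral_eq_cell:
  fixes u g :: "real^'d \<Rightarrow> real"
  assumes ae: "AE x in lborel. u x = g x" and [measurable]: "g \<in> borel_measurable borel"
  shows "integrable torus_measure u \<longleftrightarrow> integrable cell_measure g"
    and "(\<integral>x. u x \<partial>torus_measure) = (\<integral>x. g x \<partial>cell_measure)"
    and "u \<in> borel_measurable torus_measure"
proof -
  let ?Q = "cbox 0 One :: (real^'d) set"
  have "AE x in lebesgue. g x = u x"
    using ae by (auto intro!: AE_completion elim: eventually_mono)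
  then have u [measurable]: "u \<in> borel_measurable lebesgue"
    by (rule borel_measurable_AE[rotated]) (auto intro: measurable_completion)
  then show "u \<in> borel_measurable torus_measure"
    by (simp add: torus_measure_def measurable_restrict_space1)
  have Q: "?Q \<inter> space lebesgue \<in> sets lebesgue" by simp
  have Qu: "(\<lambda>x. indicator ?Q x * u x) \<in> borel_measurable lebesgue"
    by (intro borel_measurable_times borel_measurable_indicator u) simp
  have ae': "AE x in lebesgue. indicator ?Q x *\<^sub>R u x = indicator unit_cell x *\<^sub>R g x"
  proof (rule AE_completion)
    show "AE x in lborel. indicator ?Q x *\<^sub>R u x = indicator unit_cell x *\<^sub>R g x"
      using ae AE_cbox_iff_unit_cell by eventually_elim (simp add: indicator_def)
  qed
  have cell: "cell_measure = density lborel (\<lambda>x. ennreal (indicator unit_cell (x :: real^'d)))"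
    by (simp add: cell_measure_def ennreal_indicator)
  have "integrable torus_measure u \<longleftrightarrow> integrable lebesgue (\<lambda>x. indicator ?Q x *\<^sub>R u x)"
    unfolding torus_measure_def by (rule integrable_restrict_space[OF Q])
  also have "\<dots> \<longleftrightarrow> integrable lebesgue (\<lambda>x. indicator unit_cell x *\<^sub>R g x)"
    by (rule integrable_cong_AE) (use ae' Qu in \<open>auto intro: measurable_completion\<close>)
  also have "\<dots> \<longleftrightarrow> integrable lborel (\<lambda>x. indicator unit_cell x *\<^sub>R g x)"
    by (rule integrable_completion) simp
  also have "\<dots> \<longleftrightarrow> integrable cell_measure g"
    unfolding cell by (rule integrable_density[symmetric]) auto
  finally show "integrable torus_measure u \<longleftrightarrow> integrable cell_measure g" .
  have "(\<integral>x. u x \<partial>torus_measure) = (\<integral>x. indicator ?Q x *\<^sub>R u x \<partial>lebesgue)"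
    unfolding torus_measure_def by (rule integral_restrict_space[OF Q])
  also have "\<dots> = (\<integral>x. indicator unit_cell x *\<^sub>R g x \<partial>lebesgue)"
    by (rule integral_cong_AE) (use ae' Qu in \<open>auto intro: measurable_completion\<close>)
  also have "\<dots> = (\<integral>x. indicator unit_cell x *\<^sub>R g x \<partial>lborel)"
    by (rule integral_completion) simp
  also have "\<dots> = (\<integral>x. g x \<partial>cell_measure)"
    unfolding cell by (rule integral_density[symmetric]) auto
  finally show "(\<integral>x. u x \<partial>torus_measure) = (\<integral>x. g x \<partial>cell_measure)" .
qed

text \<open>Take a Borel version on the cube and extend it periodically by \<open>vfrac\<close>. A
  point can be exceptional only if one of its countably many integer translates is, so the
  exceptional set is null.\<close>

lemma ex_periodic_borel:
  fixes f :: "real^'d \<Rightarrow> real"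
  assumes per: "periodic_fun f" and meas: "f \<in> borel_measurable torus_measure"
  shows "\<exists>g. g \<in> borel_measurable borel \<and> zperiodic g \<and> (AE x in lborel. f x = g x)"
proof -
  let ?Q = "cbox 0 One :: (real^'d) set"
  have "(\<lambda>x. indicator ?Q x *\<^sub>R f x) \<in> borel_measurable lebesgue"
    using meas unfolding torus_measure_def by (subst (asm) borel_measurable_restrict_space_iff) simp_all
  then obtain h where h: "h \<in> borel_measurable lborel" "AE x in lborel. indicator ?Q x *\<^sub>R f x = h x"
    using completion_ex_borel_measurable_real by blast
  have "AE x in lborel. \<forall>k\<in>{k. int_vec k}. indicator ?Q (x + k) *\<^sub>R f (x + k) = h (x + k)"
    by (subst AE_ball_countable[OF countable_int_vec])
       (intro ballI AE_lborel_translate[where P = "\<lambda>x. indicator ?Q x *\<^sub>R f x = h x"] h(2))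
  then have "AE x in lborel. f x = h (vfrac x)"
  proof (rule eventually_mono)
    fix x assume *: "\<forall>k\<in>{k. int_vec k}. indicator ?Q (x + k) *\<^sub>R f (x + k) = h (x + k)"
    have "vfrac x \<in> ?Q" using vfrac_in_cell unit_cell_subset_cbox by blast
    moreover have "f (x + (vfrac x - x)) = f x"
      using per int_vec_vfrac_diff[of x] unfolding periodic_fun_def by blast
    ultimately show "f x = h (vfrac x)"
      using bspec[OF *, of "vfrac x - x"] int_vec_vfrac_diff[of x] by simp
  qed
  moreover have "(\<lambda>x. h (vfrac x)) \<in> borel_measurable borel" using h(1) by simp
  ultimately show ?thesis using zperiodic_comp_vfrac[of h] by blast
qed

section \<open>The estimate for one integral matrix: finite exponents and the supremum norm\<close>

lemma transfer_Lp_modulus: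
  fixes f :: "real^'d \<Rightarrow> real" and N :: nat and \<delta> :: real
  assumes p: "p \<ge> 1" and per: "periodic_fun f" and f: "in_Lr (ereal p) f"
    and mean: "integral\<^sup>L torus_measure f = 0"
    and B: "integral_matrix B" "det B \<noteq> 0" "digit_set B D" and N: "N \<ge> 1" and \<delta>: "\<delta> \<ge> 0"
    and cover: "\<And>t. \<exists>m w. int_vec m \<and> t - m = B *v w \<and> norm w \<le> N * \<delta>"
  shows "ereal (Lr_norm (ereal p) (transfer B D f)) \<le> ereal N * modulus (ereal p) f \<delta>"
proof -
  have fm: "f \<in> borel_measurable torus_measure" "integrable torus_measure (\<lambda>x. \<bar>f x\<bar> powr p)"
    using f by (auto simp: in_Lr_def)
  obtain g where gm [measurable]: "g \<in> borel_measurable borel" and gp: "zperiodic g"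
    and ae: "AE x in lborel. f x = g x"
    using ex_periodic_borel[OF per fm(1)] by blast
  \<comment> \<open>The norm sees only the almost-everywhere class, so f, its transfer and each
    difference in the modulus can be replaced by Borel versions.\<close>
  have norm_eq: "Lr_norm (ereal p) u = (\<integral>x. \<bar>v x\<bar> powr p \<partial>cell_measure) powr (1 / p)"
    if "AE x in lborel. u x = v x" "v \<in> borel_measurable borel" for u v :: "real^'d \<Rightarrow> real"
    using torus_integral_eq_cell(2)[of "\<lambda>x. \<bar>u x\<bar> powr p" "\<lambda>x. \<bar>v x\<bar> powr p"] that
    by (simp add: Lr_norm_def eventually_mono)
  have g: "cell_Lp p g"
  proof -
    have "AE x in lborel. \<bar>f x\<bar> powr p = \<bar>g x\<bar> powr p" using ae by (rule eventually_mono) simp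
    then have "integrable cell_measure (\<lambda>x. \<bar>g x\<bar> powr p)"
      using torus_integral_eq_cell(1)[of "\<lambda>x. \<bar>f x\<bar> powr p" "\<lambda>x. \<bar>g x\<bar> powr p"] fm(2) by simp
    then show ?thesis using gm gp by (simp add: cell_Lp_def)
  qed
  have mean_g: "(\<integral>x. g x \<partial>cell_measure) = 0"
    using torus_integral_eq_cell(2)[OF ae gm] mean by simp
  have diff_norm: "Lr_norm (ereal p) (\<lambda>x. f (x + v) - f x) = (\<integral>x. \<bar>g (x + v) - g x\<bar> powr p \<partial>cell_measure) powr (1 / p)" for v
  proof (rule norm_eq)
    show "AE x in lborel. f (x + v) - f x = g (x + v) - g x"
      using AE_lborel_translate[OF ae, of v] ae by eventually_elim simp
  qed simp
  have le_mod: "ereal (Lr_norm (ereal p) (\<lambda>x. f (x + v) - f x)) \<le> modulus (ereal p) f \<delta>" if "norm v \<le> \<delta>" for v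
    unfolding modulus_def using that by (auto intro: SUP_upper)
  \<comment> \<open>The translation v = 0 is admissible, which excludes the value -\<infinity>. If
    the modulus is \<infinity>, the claim is trivial as N \<ge> 1.\<close>
  have "0 \<le> modulus (ereal p) f \<delta>"
    by (rule order_trans[OF _ le_mod[of 0]]) (use \<delta> in \<open>simp_all add: Lr_norm_def\<close>)
  then consider "modulus (ereal p) f \<delta> = \<infinity>" | k where "k \<ge> 0" "modulus (ereal p) f \<delta> = ereal k"
    by (cases "modulus (ereal p) f \<delta>") auto
  then show ?thesis
  proof cases
    case 1
    then show ?thesis using N by simp
  next
    case 2
    have bound: "(\<integral>x. \<bar>g (x + v) - g x\<bar> powr p \<partial>cell_measure) \<le> k powr p" if "norm v \<le> \<delta>" for v
    proof -
      let ?I = "\<integral>x. \<bar>g (x + v) - g x\<bar> powr p \<partial>cell_measure"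
      have "?I powr (1 / p) \<le> k" using le_mod[OF that] 2 by (simp add: diff_norm)
      then have "(?I powr (1 / p)) powr p \<le> k powr p" using p by (intro powr_mono2) auto
      then show ?thesis using p by (simp add: powr_powr)
    qed
    have "(\<integral>x. \<bar>transfer B D g x\<bar> powr p \<partial>cell_measure) \<le> N powr p * k powr p"
      by (rule transfer_Lp_bound[OF p g mean_g B cover])
         (rule Lp_modulus_multiple[OF p g N bound])
    then have "(\<integral>x. \<bar>transfer B D g x\<bar> powr p \<partial>cell_measure) powr (1 / p) \<le> ((N * k) powr p) powr (1 / p)"
      using p 2 by (intro powr_mono2) (auto simp: powr_mult)
    also have "\<dots> = N * k" using p 2 by (simp add: powr_powr)
    finally have "(\<integral>x. \<bar>transfer B D g x\<bar> powr p \<partial>cell_measure) powr (1 / p) \<le> N * k" .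
    moreover have "Lr_norm (ereal p) (transfer B D f) = (\<integral>x. \<bar>transfer B D g x\<bar> powr p \<partial>cell_measure) powr (1 / p)"
      by (rule norm_eq[OF AE_lborel_transfer[OF ae B(2) digit_set_card(1)[OF B(3,1,2)]]]) simp
    ultimately show ?thesis using 2 by simp
  qed
qed

text \<open>The modulus bounds differences of f at every point, so the transfer \<open>F\<close>
  oscillates by at most N k everywhere. A Borel version of f supplies its mean, which is zero; hence
  |F| \<le> N k at every point.\<close>

lemma transfer_sup_modulus:
  fixes f :: "real^'d \<Rightarrow> real" and N :: nat and \<delta> :: real
  assumes per: "periodic_fun f" and f: "in_Lr \<infinity> f"
    and mean: "integral\<^sup>L torus_measure f = 0"
    and B: "integral_matrix B" "det B \<noteq> 0" "digit_set B D" and N: "N \<ge> 1" and \<delta>: "\<delta> \<ge> 0"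
    and cover: "\<And>t. \<exists>m w. int_vec m \<and> t - m = B *v w \<and> norm w \<le> N * \<delta>"
  shows "ereal (Lr_norm \<infinity> (transfer B D f)) \<le> ereal N * modulus \<infinity> f \<delta>"
proof -
  have fm: "f \<in> borel_measurable torus_measure"
    and fb: "esssup torus_measure (\<lambda>x. ereal \<bar>f x\<bar>) < \<infinity>"
    using f by (auto simp: in_Lr_def)
  have zper: "zperiodic f" using per by (simp add: zperiodic_def periodic_fun_def)
  obtain g where gm [measurable]: "g \<in> borel_measurable borel" and gp: "zperiodic g"
    and ae: "AE x in lborel. f x = g x"
    using ex_periodic_borel[OF per fm] by blast
  interpret T: finite_measure "torus_measure :: (real^'d) measure"
    unfolding torus_measure_def by (rule finite_measure_lebesgue_on) simp
  have "integrable torus_measure f"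
  proof -
    obtain c where c: "esssup torus_measure (\<lambda>x. ereal \<bar>f x\<bar>) \<le> ereal c"
      using fb by (cases "esssup torus_measure (\<lambda>x. ereal \<bar>f x\<bar>)") auto
    have "AE x in torus_measure. norm (f x) \<le> c"
      using esssup_AE[of "\<lambda>x. ereal \<bar>f x\<bar>" torus_measure]
    proof (rule eventually_mono)
      fix x assume "ereal \<bar>f x\<bar> \<le> esssup torus_measure (\<lambda>x. ereal \<bar>f x\<bar>)"
      then have "ereal \<bar>f x\<bar> \<le> ereal c" using c by (rule order_trans)
      then show "norm (f x) \<le> c" by simp
    qed
    then show ?thesis using fm by (rule T.integrable_const_bound)
  qed
  then have gi: "integrable cell_measure g" using torus_integral_eq_cell(1)[OF ae gm] by simp
  have mean_g: "(\<integral>x. g x \<partial>cell_measure) = 0"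
    using torus_integral_eq_cell(2)[OF ae gm] mean by simp
  have le_mod: "ereal \<bar>f (x + v) - f x\<bar> \<le> modulus \<infinity> f \<delta>" if "norm v \<le> \<delta>" for x v
  proof -
    have "torus_dist (x + v) x \<le> norm (x + v - x - 0)"
      unfolding torus_dist_def
    proof (rule cInf_lower)
      show "norm (x + v - x - 0) \<in> {norm (x + v - x - k) |k. int_vec k}" using int_vec_0 by blast
      show "bdd_below {norm (x + v - x - k) |k. int_vec k}" by (rule bdd_belowI[of _ 0]) auto
    qed
    then have "torus_dist (x + v) x \<le> \<delta>" using that by simp
    then show ?thesis unfolding modulus_def by (auto intro!: SUP_upper2[of "(x + v, x)"])
  qed
  have "0 \<le> modulus \<infinity> f \<delta>"
    by (rule order_trans[OF _ le_mod[of 0 0]]) (use \<delta> in simp_all)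
  then consider "modulus \<infinity> f \<delta> = \<infinity>" | k where "k \<ge> 0" "modulus \<infinity> f \<delta> = ereal k"
    by (cases "modulus \<infinity> f \<delta>") auto
  then show ?thesis
  proof cases
    case 1
    then show ?thesis using N by simp
  next
    case 2
    have small: "\<bar>f x - f (x + v)\<bar> \<le> N * k" if v: "norm v \<le> N * \<delta>" for x v
    proof -
      define w where "w = (1 / N) *\<^sub>R v"
      have w: "norm w \<le> \<delta>" using v N by (simp add: w_def divide_le_eq mult.commute)
      have "\<bar>f (x + real n *\<^sub>R w) - f x\<bar> \<le> n * k" for n
      proof (induction n)
        case (Suc n)
        have "\<bar>f (x + real n *\<^sub>R w + w) - f (x + real n *\<^sub>R w)\<bar> \<le> k"
          using le_mod[OF w] 2 by simp
        moreover have e: "x + real (Suc n) *\<^sub>R w = x + real n *\<^sub>R w + w" by (simp add: algebra_simps)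
        ultimately show ?case unfolding e unfolding of_nat_Suc distrib_right using Suc.IH by linarith
      qed simp
      from this[of N] show ?thesis using N by (simp add: w_def abs_minus_commute)
    qed
    note card = digit_set_card[OF B(3,1,2)]
    define F where "F = transfer B D f"
    have F: "\<bar>F x - F (x + t)\<bar> \<le> N * k" for x t
    proof -
      obtain m w where w: "int_vec m" "t - m = B *v w" "norm w \<le> N * \<delta>" using cover by blast
      have "\<bar>\<Sum>h\<in>D. f (matrix_inv B *v (x + h)) - f (matrix_inv B *v (x + h) + w)\<bar> \<le> (\<Sum>h\<in>D. N * k)"
        by (rule order_trans[OF sum_abs]) (intro sum_mono small w(3))
      moreover have "F x - F (x + t) = transfer B D (\<lambda>y. f y - f (y + w)) x"
        unfolding F_def by (rule transfer_translate_diff[OF zper B w(1,2)])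
      ultimately show ?thesis
        using B(2) card by (simp add: transfer_def abs_mult divide_le_eq mult.commute)
    qed
    have aeF: "AE x in cell_measure. F x = transfer B D g x"
      unfolding F_def by (intro AE_lborel_cell AE_lborel_transfer ae B(2) card(1))
    note LG = integral_transfer[OF gm gp gi B]
    have "\<bar>F x\<bar> \<le> N * k" for x
    proof -
      have near: "AE y in cell_measure. \<bar>F x - transfer B D g y\<bar> \<le> N * k"
        using aeF
      proof (rule eventually_mono)
        fix y assume "F y = transfer B D g y"
        then show "\<bar>F x - transfer B D g y\<bar> \<le> N * k" using F[of x "y - x"] by simp
      qed
      have "(\<integral>y. F x - N * k \<partial>(cell_measure :: (real^'d) measure)) \<le> (\<integral>y. transfer B D g y \<partial>cell_measure)"
        by (rule integral_mono_AE) (use near LG in \<open>auto elim!: eventually_mono\<close>)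
      moreover have "(\<integral>y. transfer B D g y \<partial>cell_measure) \<le> (\<integral>y. F x + N * k \<partial>(cell_measure :: (real^'d) measure))"
        by (rule integral_mono_AE) (use near LG in \<open>auto elim!: eventually_mono\<close>)
      ultimately show ?thesis using LG(2) mean_g by (simp add: cell.prob_space[simplified])
    qed
    moreover have "F \<in> borel_measurable torus_measure"
      unfolding F_def by (rule torus_integral_eq_cell(3)[OF AE_lborel_transfer[OF ae B(2) card(1)]]) simp
    ultimately have "esssup torus_measure (\<lambda>x. ereal \<bar>F x\<bar>) \<le> ereal (N * k)"
      by (intro esssup_I) auto
    \<comment> \<open>At -\<infinity> the function \<open>real_of_ereal\<close> returns 0, and N k
      \<ge> 0 covers that case.\<close>
    then have "real_of_ereal (esssup torus_measure (\<lambda>x. ereal \<bar>F x\<bar>)) \<le> N * k"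
      using 2 by (cases "esssup torus_measure (\<lambda>x. ereal \<bar>F x\<bar>)") auto
    then show ?thesis using 2 by (simp add: Lr_norm_def F_def)
  qed
qed

theorem theorem2:
  fixes A :: "real^'d^'d" and r :: ereal and lam :: real
  assumes "integral_matrix A"
    and "expanding A"
    and "\<exists>z. eigenvalue A z \<and> cmod z = lam"
    and "\<forall>z. eigenvalue A z \<longrightarrow> lam \<le> cmod z"
    and "1 \<le> r"
  shows "\<exists>C>0. \<forall>D. digit_set A D \<longrightarrow>
    (\<forall>f. periodic_fun f \<and> in_Lr r f \<and> integral\<^sup>L torus_measure f = 0 \<longrightarrow>
      (\<forall>n::nat. n \<ge> 1 \<longrightarrow>
        ereal (Lr_norm r ((transfer A D ^^ n) f)) \<le> ereal C * modulus r f (inverse (lam ^ n))))"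
proof -
  have lam: "lam > 1" using assms(2,3) by (auto simp: expanding_def)
  \<comment> \<open>A real kernel vector is also a complex one, so a singular A would have the
    eigenvalue 0.\<close>
  have "det A \<noteq> 0"
  proof
    assume "det A = 0"
    then obtain v where "v \<noteq> 0" "A *v v = 0"
      using invertible_det_nz matrix_left_invertible_ker invertible_left_inverse by metis
    then have "cmat A *v (\<chi> i. complex_of_real (v $ i)) = 0" "(\<chi> i. complex_of_real (v $ i)) \<noteq> 0"
      by (auto simp: vec_eq_iff cmat_def matrix_vector_mult_def simp flip: of_real_mult of_real_sum)
    then have "det (cmat A) = 0"
      using invertible_det_nz matrix_left_invertible_ker invertible_left_inverse by metis
    then have "eigenvalue A 0" by (simp add: eigenvalue_def)
    then show False using assms(2) by (auto simp: expanding_def)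
  qed
  obtain C where C: "C > 0" and cover: "\<And>n y. \<exists>m w. int_vec m \<and> y - m = (((*v) A) ^^ n) w \<and> norm w \<le> C * inverse (lam ^ n)"
    using lattice_covering_radius[OF assms(1-4)] by blast
  \<comment> \<open>Enough steps of length at most \<lambda>^-n to make up any translation of length
    at most C \<lambda>^-n; it depends on A alone.\<close>
  define N where "N = nat \<lceil>C\<rceil>"
  have N: "N \<ge> 1" "C \<le> N" using C by (simp_all add: N_def) linarith+
  have "ereal (Lr_norm r ((transfer A D ^^ n) f)) \<le> ereal N * modulus r f (inverse (lam ^ n))"
    if D: "digit_set A D" and f: "periodic_fun f" "in_Lr r f" "integral\<^sup>L torus_measure f = 0" for D f n
  proof -
    obtain B E where B: "integral_matrix B" "det B \<noteq> 0" "digit_set B E"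
      "\<And>x. B *v x = (((*v) A) ^^ n) x" "transfer A D ^^ n = transfer B E"
      using transfer_power[OF assms(1) \<open>det A \<noteq> 0\<close> D] by blast
    have \<delta>: "inverse (lam ^ n) \<ge> 0" using lam by simp
    have "C * inverse (lam ^ n) \<le> N * inverse (lam ^ n)"
      using N \<delta> by (intro mult_right_mono)
    then have cov: "\<exists>m w. int_vec m \<and> t - m = B *v w \<and> norm w \<le> N * inverse (lam ^ n)" for t
      using cover[of t n] B(4) by (metis order_trans)
    show ?thesis
    proof (cases r)
      case (real p)
      then have "p \<ge> 1" using assms(5) by simp
      then show ?thesis
        unfolding B(5) real using f real by (intro transfer_Lp_modulus B(1-3) N \<delta> cov) auto
    next
      case PInf
      then show ?thesis
        unfolding B(5) PInf using f PInf by (intro transfer_sup_modulus B(1-3) N \<delta> cov) auto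
    qed (use assms(5) in simp)
  qed
  then show ?thesis using N by (intro exI[of _ "real N"]) auto
qed

end
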